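(* Let $s>0$, $k=1/s$, let $m=(m(n))_{n\ge 0}$ be a sequence preserving summability which satisfies $a^n\le m(n)\le A^n$ for all $n\in\mathbb{N}_0$ with some constants $a,A>0$, let $\tilde m=\Gamma_s m=(\Gamma(1+sn)m(n))_{n\ge 0}$ be the corresponding sequence of generalized moments of order $s$, and let $\varphi$ be holomorphic on $D_r=\{z\in\mathbb{C}:|z|<r\}$ for some $r>0$. Then the $\tilde m$-moment derivatives $\partial_{\tilde m,z}^n$ of $\varphi$ have the following integral representation for every $n\in\mathbb{N}_0$ and $|z|<\varepsilon<r/A$: $$\partial_{\tilde m,z}^n\varphi(z)=\frac{1}{2\pi i}\oint_{|w|=\varepsilon}(\mathcal{B}_{m^{-1}}\varphi)(w)\int_0^{\infty(e^{i\theta})}\zeta^n E_{\tilde m}(z\zeta)\,k(w\zeta)^{k-1}e^{-(w\zeta)^k}\,d\zeta\,dw,$$ where $\theta\in(-\arg w-\frac{\pi}{2k},-\arg w+\frac{\pi}{2k})$ and $E_{\tilde m}(z)=\sum_{n=0}^\infty \frac{z^n}{\tilde m(n)}$.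
   Context: All sequences $m=(m(n))_{n\ge0}$ are sequences of positive real numbers with $m(0)=1$; products of sequences are termwise, and $m^{-1}=(m(n)^{-1})_{n\ge0}$. The notation $\int_0^{\infty(e^{i\theta})}$ means integration along the half-line from $0$ to $\infty$ in the direction $\theta$. For a complex Banach space $\mathbb{E}$, the $m$-Borel operator on formal power series is $\hat{\mathcal{B}}_m\big(\sum_n a_nt^n\big)=\sum_n\frac{a_n}{m(n)}t^n$. For $\varphi(z)=\sum_n\varphi_nz^n$ holomorphic on $D_r$, $\mathcal{B}_{m^{-1}}\varphi$ is the function $\mathcal{B}_{m^{-1}}\varphi(w)=\sum_n m(n)\varphi_nw^n$, which is holomorphic on $D_{r/A}$. The $\tilde m$-moment differential operator is $\partial_{\tilde m,z}\big(\sum_n u_nz^n\big)=\sum_n\frac{\tilde m(n+1)}{\tilde m(n)}u_{n+1}z^n$, and $\partial_{\tilde m,z}^n$ is its $n$-th iterate. Summability. For $d\in\mathbb{R}$, $\alpha>0$ let $S_d(\alpha)$ be the unbounded sector $\{re^{i\phi}: r>0,\ |\phi-d|<\alpha/2\}$ in the universal covering of $\mathbb{C}\setminus\{0\}$. For $k>0$, $\mathcal{O}^k(S_d(\alpha)\cup D_r,\mathbb{E})$ is the space of $\mathbb{E}$-valued holomorphic functions $f$ on $S_d(\alpha)\cup D_r$ such that for all $\tilde\alpha\in(0,\alpha)$, $\tilde r\in(0,r)$ there are $C,B>0$ with $\|f(t)\|<Ce^{B|t|^k}$ on $S_d(\tilde\alpha)\cup D_{\tilde r}$. Write $\Gamma_s=(\Gamma(1+sn))_{n\ge0}$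 for $s\ge0$. A series $\hat u\in\mathbb{E}[[t]]$ is $k$-summable in the direction $d$ (written $\hat u\in\mathbb{E}\{t\}_{k,d}$) if $\hat{\mathcal{B}}_{\Gamma_{1/k}}\hat u\in\mathcal{O}^k(S_d(\alpha)\cup D_r,\mathbb{E})$ for some $\alpha,r>0$. A sequence $m$ preserves summability if for every $k>0$, $d\in\mathbb{R}$ and every $\hat u\in\mathbb{E}[[t]]$ ($\mathbb{E}$ a complex Banach space): $\hat u\in\mathbb{E}\{t\}_{k,d}$ if and only if $\hat{\mathcal{B}}_m\hat u\in\mathbb{E}\{t\}_{k,d}$. (Every such sequence satisfies $a^n\le m(n)\le A^n$ for some $a,A>0$.) A sequence of generalized moments of order $s\ge0$ is a sequence $\tilde m=m\Gamma_s$, where $m$ preserves summability.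
   Formalization: Added: |z| < ε·liminf m(n)^{1/n}, and θ(w) limited to directions where the inner integral converges absolutely (always so for θ near −arg w). As stated it fails: for s=1, m(n)=a^n, a<1, aε<|z|<ε, w=εz/|z|, the inner integral diverges for every θ. *)

theory Defs
  imports "HOL-Complex_Analysis.Complex_Analysis"
begin

section \<open>Complex Banach spaces\<close>

class complex_banach = banach +
  fixes scaleC :: "complex \<Rightarrow> 'a \<Rightarrow> 'a"  (infixr "*\<^sub>C" 75)
  assumes scaleC_add_right: "c *\<^sub>C (x + y) = c *\<^sub>C x + c *\<^sub>C y"
    and scaleC_add_left: "(c + c') *\<^sub>C x = c *\<^sub>C x + c' *\<^sub>C x"
    and scaleC_scaleC: "c *\<^sub>C (c' *\<^sub>C x) = (c * c') *\<^sub>C x"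
    and scaleC_of_real: "complex_of_real b *\<^sub>C x = b *\<^sub>R x"
    and norm_scaleC: "norm (c *\<^sub>C x) = norm c * norm x"

instantiation complex :: complex_banach
begin

definition scaleC_complex :: "complex \<Rightarrow> complex \<Rightarrow> complex"
  where "scaleC_complex c x = c * x"

instance
  by standard (auto simp: scaleC_complex_def algebra_simps norm_mult scaleR_conv_of_real)

end

text \<open>The library's \<^const>\<open>holomorphic_on\<close> only covers functions with values in the field itself.\<close>

definition vholomorphic_on :: "(complex \<Rightarrow> 'e::complex_banach) \<Rightarrow> complex set \<Rightarrow> bool"
    (infixl "vholomorphic'_on" 50)
  where "f vholomorphic_on S \<longleftrightarrow>
    (\<forall>x\<in>S. \<exists>D. (f has_derivative (\<lambda>h. h *\<^sub>C D)) (at x within S))"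

lemma vholomorphic_on_complex_iff:
  fixes f :: "complex \<Rightarrow> complex"
  shows "f vholomorphic_on S \<longleftrightarrow> f holomorphic_on S"
  by (simp add: vholomorphic_on_def holomorphic_on_def field_differentiable_def
      has_field_derivative_def scaleC_complex_def mult.commute)


section \<open>Moment sequences, Borel operators, moment derivatives\<close>

definition Gamma_seq :: "real \<Rightarrow> nat \<Rightarrow> real"
  where "Gamma_seq s n = Gamma (1 + s * real n)"

definition borel_op :: "(nat \<Rightarrow> real) \<Rightarrow> 'e::real_vector fps \<Rightarrow> 'e fps"
  where "borel_op m u = Abs_fps (\<lambda>n. fps_nth u n /\<^sub>R m n)"

definition moment_deriv :: "(nat \<Rightarrow> real) \<Rightarrow> 'e::real_vector fps \<Rightarrow> 'e fps"
  where "moment_deriv M u = Abs_fps (\<lambda>n. (M (n + 1) / M n) *\<^sub>R fps_nth u (n + 1))"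

definition generalized_moments :: "real \<Rightarrow> (nat \<Rightarrow> real) \<Rightarrow> nat \<Rightarrow> real"
  where "generalized_moments s m n = Gamma_seq s n * m n"

text \<open>The operators on functions holomorphic near 0, acting through the Taylor series at 0.\<close>

definition borel_fun :: "(nat \<Rightarrow> real) \<Rightarrow> (complex \<Rightarrow> complex) \<Rightarrow> complex \<Rightarrow> complex"
  where "borel_fun m \<phi> = eval_fps (borel_op m (fps_expansion \<phi> 0))"

definition moment_deriv_series :: "(nat \<Rightarrow> real) \<Rightarrow> nat \<Rightarrow> (complex \<Rightarrow> complex) \<Rightarrow> complex fps"
  where "moment_deriv_series M n \<phi> = (moment_deriv M ^^ n) (fps_expansion \<phi> 0)"

definition moment_exp :: "(nat \<Rightarrow> real) \<Rightarrow> complex \<Rightarrow> complex"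
  where "moment_exp M z = (\<Sum>n. z ^ n / of_real (M n))"


section \<open>Summability\<close>

text \<open>
  Points of the universal covering of the punctured plane are given by their logarithm, with
  covering map \<^const>\<open>exp\<close>; so the unbounded sector of opening \<open>\<alpha>\<close> (possibly larger
  than \<open>2\<pi>\<close>) in the direction \<open>d\<close> is the following horizontal strip.
\<close>

definition log_sector :: "real \<Rightarrow> real \<Rightarrow> complex set"
  where "log_sector d \<alpha> = {l. \<bar>Im l - d\<bar> < \<alpha> / 2}"

text \<open>
  A function on the union of the sector and the disc of radius \<open>r\<close> is a pair: \<open>F\<close> on the sector
  (in the logarithmic coordinate) and \<open>g\<close> on the disc, agreeing where the two overlap.
\<close>

definition holomorphic_growth ::
  "real \<Rightarrow> real \<Rightarrow> real \<Rightarrow> real \<Rightarrow> (complex \<Rightarrow> 'e::complex_banach) \<Rightarrow> (complex \<Rightarrow> 'e) \<Rightarrow> bool"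
  where "holomorphic_growth k d \<alpha> r F g \<longleftrightarrow>
    F vholomorphic_on log_sector d \<alpha> \<and>
    g vholomorphic_on ball 0 r \<and>
    (\<forall>l\<in>log_sector d \<alpha>. exp l \<in> ball 0 r \<longrightarrow> F l = g (exp l)) \<and>
    (\<forall>\<alpha>' r'. 0 < \<alpha>' \<and> \<alpha>' < \<alpha> \<and> 0 < r' \<and> r' < r \<longrightarrow>
      (\<exists>C>0. \<exists>B>0.
        (\<forall>l\<in>log_sector d \<alpha>'. norm (F l) < C * exp (B * norm (exp l) powr k)) \<and>
        (\<forall>t\<in>ball 0 r'. norm (g t) < C * exp (B * norm t powr k))))"

definition summable_in_dir :: "real \<Rightarrow> real \<Rightarrow> 'e::complex_banach fps \<Rightarrow> bool"
  where "summable_in_dir k d u \<longleftrightarrow>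
    (\<exists>\<alpha>>0. \<exists>r>0. \<exists>F g. holomorphic_growth k d \<alpha> r F g \<and>
      (\<forall>t\<in>ball 0 r. (\<lambda>n. t ^ n *\<^sub>C fps_nth (borel_op (Gamma_seq (1 / k)) u) n) sums g t))"

text \<open>HOL cannot quantify over types inside a formula, so the Banach space is a type argument.\<close>

definition preserves_summability :: "'e::complex_banach itself \<Rightarrow> (nat \<Rightarrow> real) \<Rightarrow> bool"
  where "preserves_summability _ m \<longleftrightarrow>
    (\<forall>k>0. \<forall>d. \<forall>u :: 'e fps. summable_in_dir k d u \<longleftrightarrow> summable_in_dir k d (borel_op m u))"


section \<open>The inner integral\<close>

text \<open>
  \<open>(\<rho> e\<^sup>i\<^sup>\<psi>)\<^sup>\<kappa>\<close> on the universal covering: the argument \<open>\<psi>\<close> is not reduced modulo \<open>2\<pi>\<close>.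
\<close>

definition polar_powr :: "real \<Rightarrow> real \<Rightarrow> real \<Rightarrow> complex"
  where "polar_powr \<rho> \<psi> \<kappa> = of_real (\<rho> powr \<kappa>) * cis (\<kappa> * \<psi>)"

text \<open>
  The half-line in the direction \<open>\<theta>\<close> is parametrised by \<open>\<zeta> = t e\<^sup>i\<^sup>\<theta>\<close> with \<open>t > 0\<close>, so
  \<open>d\<zeta> = e\<^sup>i\<^sup>\<theta> dt\<close>, and \<open>w\<zeta>\<close> has modulus \<open>\<bar>w\<bar> t\<close> and argument \<open>arg w + \<theta>\<close>. The condition on
  \<open>\<theta>\<close> (see \<open>admissible_dir\<close>) and all values below depend only on \<open>e\<^sup>i\<^sup>\<theta>\<close> and \<open>arg w + \<theta>\<close>, so the
  choice of the branch \<^const>\<open>Arg\<close> is immaterial.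
\<close>

definition ray_integrand ::
  "real \<Rightarrow> (nat \<Rightarrow> real) \<Rightarrow> nat \<Rightarrow> complex \<Rightarrow> complex \<Rightarrow> real \<Rightarrow> real \<Rightarrow> complex"
  where "ray_integrand k M n z w \<theta> t =
    (let \<zeta> = of_real t * cis \<theta>; \<rho> = norm w * t; \<psi> = Arg w + \<theta>
     in \<zeta> ^ n * moment_exp M (z * \<zeta>) *
        (of_real k * polar_powr \<rho> \<psi> (k - 1) * exp (- polar_powr \<rho> \<psi> k)) * cis \<theta>)"

definition ray_integral ::
  "real \<Rightarrow> (nat \<Rightarrow> real) \<Rightarrow> nat \<Rightarrow> complex \<Rightarrow> complex \<Rightarrow> real \<Rightarrow> complex"
  where "ray_integral k M n z w \<theta> = (LINT t:{0<..}|lborel. ray_integrand k M n z w \<theta> t)"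

definition ray_converges ::
  "real \<Rightarrow> (nat \<Rightarrow> real) \<Rightarrow> nat \<Rightarrow> complex \<Rightarrow> complex \<Rightarrow> real \<Rightarrow> bool"
  where "ray_converges k M n z w \<theta> \<longleftrightarrow>
    set_integrable lborel {0<..} (ray_integrand k M n z w \<theta>)"

definition admissible_dir :: "real \<Rightarrow> complex \<Rightarrow> real \<Rightarrow> bool"
  where "admissible_dir k w \<theta> \<longleftrightarrow> \<theta> \<in> {- Arg w - pi / (2 * k) <..< - Arg w + pi / (2 * k)}"

end

theory Submission
  imports Defs
begin

text \<open>
  Write \<open>M j = Gamma (1 + s j) * m j\<close>. For integration along a single ray, expanding \<open>E\<^sub>M\<close> and
  substituting \<open>x = (w \<zeta>)\<^sup>k\<close> turns each term into a Gamma integral, so that formally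
  \<open>\<integral> \<zeta>\<^sup>n E\<^sub>M(z \<zeta>) k (w \<zeta>) powr (k - 1) exp (- (w \<zeta>) powr k) d\<zeta> =
   (\<Sum>j. z ^ j / M j * Gamma (1 + s (n + j)) / w ^ (n + j + 1))\<close>.
  The Borel transform of \<open>\<phi>\<close> has Taylor coefficients \<open>m l * \<phi>\<^sub>l\<close>. Multiplying it with the series above
  and integrating over the circle, Cauchy's formula selects \<open>l = n + j\<close> and yields
  \<open>\<Sum>j. M (n + j) / M j * \<phi>\<^sub>n\<^sub>+\<^sub>j * z ^ j\<close>, which is the \<open>n\<close>-th moment derivative at \<open>z\<close>
  (\<open>contour_integral_Laurent_pairing\<close>).

  The series with quotients of moments converge by a root test: \<open>Gamma (1 + s (n + j)) / Gamma (1 + s j)\<close> grows only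
  polynomially in \<open>j\<close>, while \<open>m j\<close> eventually dominates \<open>y ^ j\<close> for every \<open>y > 0\<close> below the lower limit
  of its \<open>j\<close>-th roots (\<open>summable_generalized_moment_ratio\<close>). The same test, with \<open>\<epsilon>\<close> replaced by
  \<open>\<epsilon> cos (k (Arg w + \<theta>)) powr (1 / k)\<close>, gives absolute convergence of the ray integral
  (\<open>ray_convergesI\<close>).

  The delicate point is the evaluation of a ray integral that is merely known to converge. The
  direction may be so oblique that the termwise integrals do not converge absolutely, and the formal
  computation is not justified on the ray itself. Instead of rotating the ray, a parameter is
  introduced: the integrand is damped by \<open>exp (- \<tau> x)\<close>, \<open>x = (\<bar>w\<bar> t) powr k\<close>. For large \<open>Re \<tau>\<close> the
  termwise computation is legitimate, both sides are holomorphic in \<open>\<tau>\<close>, and \<open>\<tau>\<close> tends to 0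
  (\<open>laplace_series_of_integrable\<close>). Applied to every point of the circle, this makes the value of the
  ray integral independent of the choice of admissible directions (\<open>ray_integral_sums\<close>).
\<close>

section \<open>Laplace integrals of powers\<close>

lemma absolutely_integrable_on_iff_lebesgue_on:
  fixes f :: "real \<Rightarrow> 'a::{banach, second_countable_topology}"
  assumes "S \<in> sets lebesgue"
  shows "f absolutely_integrable_on S \<longleftrightarrow> integrable (lebesgue_on S) f"
  using assms by (simp add: set_integrable_def integrable_restrict_space)

lemma Gamma_laplace_real:
  fixes b p :: real
  assumes "b > -1" "p > 0"
  shows "integrable (lebesgue_on {0<..}) (\<lambda>x. x powr b * exp (- p * x))" (is ?int)
    and "(\<integral>x. x powr b * exp (- p * x) \<partial>lebesgue_on {0<..}) = Gamma (1 + b) * p powr (-1 - b)"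
      (is ?eq)
proof -
  have unit: "(\<lambda>x. x powr b * exp (- x)) absolutely_integrable_on {0<..}"
  proof -
    have "(\<lambda>t. complex_of_real t powr (complex_of_real (1 + b) - 1) / of_real (exp t))
            absolutely_integrable_on {0<..}"
      by (rule absolutely_integrable_Gamma_integral') (use assms in auto)
    from absolutely_integrable_norm[OF this]
    have "(\<lambda>t. norm (complex_of_real t powr (complex_of_real (1 + b) - 1) / of_real (exp t)))
            absolutely_integrable_on {0<..}" 
      by (simp add: o_def)
    then show ?thesis
      by (rule set_integrable_cong[THEN iffD1, rotated -1])
         (auto simp: norm_divide norm_powr_real_powr exp_minus field_simps)
  qed
  have unit_eq: "integral {0<..} (\<lambda>x. x powr b * exp (- x)) = Gamma (1 + b)"
  proof -
    have "((\<lambda>t. t powr (1 + b - 1) / exp t) has_integral Gamma (1 + b)) {0..}"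
      by (rule Gamma_integral_real) (use assms in auto)
    then have "((\<lambda>t. t powr (1 + b - 1) / exp t) has_integral Gamma (1 + b)) {0<..}"
      by (subst (asm) has_integral_spike_set_eq[where T = "{0<..}"])
         (auto intro: negligible_subset[of "{0}"])
    then show ?thesis
      by (intro integral_unique) (simp add: exp_minus field_simps)
  qed
  have img: "(\<lambda>x. p * x) ` {0<..} = {0<..}"
  proof safe
    fix x :: real assume "x > 0"
    then show "x \<in> (\<lambda>x. p * x) ` {0<..}"
      using assms by (intro image_eqI[of _ _ "x / p"]) auto
  qed (use assms in auto)
  have "(\<lambda>x. \<bar>p\<bar> *\<^sub>R ((p * x) powr b * exp (- (p * x)))) absolutely_integrable_on {0<..} \<and>
      integral {0<..} (\<lambda>x. \<bar>p\<bar> *\<^sub>R ((p * x) powr b * exp (- (p * x)))) = Gamma (1 + b)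
    \<longleftrightarrow> (\<lambda>x. x powr b * exp (- x)) absolutely_integrable_on ((\<lambda>x. p * x) ` {0<..}) \<and>
      integral ((\<lambda>x. p * x) ` {0<..}) (\<lambda>x. x powr b * exp (- x)) = Gamma (1 + b)"
    by (rule has_absolute_integral_change_of_variables_real)
       (use assms in \<open>auto intro!: derivative_eq_intros inj_onI\<close>)
  then have scaled:
    "(\<lambda>x. p * ((p * x) powr b * exp (- (p * x)))) absolutely_integrable_on {0<..}"
    "integral {0<..} (\<lambda>x. p * ((p * x) powr b * exp (- (p * x)))) = Gamma (1 + b)"
    using unit unit_eq assms unfolding img by auto
  have int: "integrable (lebesgue_on {0<..}) (\<lambda>x. p * ((p * x) powr b * exp (- (p * x))))"
    using scaled(1) by (simp add: absolutely_integrable_on_iff_lebesgue_on)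
  have eq: "(\<integral>x. p * ((p * x) powr b * exp (- (p * x))) \<partial>lebesgue_on {0<..}) = Gamma (1 + b)"
    using scaled lebesgue_integral_eq_integral[OF int] by simp
  have *: "p powr (-1 - b) * (p * ((p * x) powr b * exp (- (p * x)))) = x powr b * exp (- p * x)"
    if "x \<in> space (lebesgue_on {0<..})" for x
    using that assms by (simp add: powr_mult powr_diff powr_minus field_simps space_restrict_space)
  show ?int
    by (subst Bochner_Integration.integrable_cong[OF refl *[symmetric]])
       (use int in \<open>auto intro!: integrable_mult_right\<close>)
  have "(\<integral>x. x powr b * exp (- p * x) \<partial>lebesgue_on {0<..}) =
      (\<integral>x. p powr (-1 - b) * (p * ((p * x) powr b * exp (- (p * x)))) \<partial>lebesgue_on {0<..})"
    by (rule Bochner_Integration.integral_cong) (simp_all only: *)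
  also have "\<dots> = p powr (-1 - b) * Gamma (1 + b)"
    by (subst integral_mult_right_zero) (simp only: eq)
  finally show ?eq
    by simp
qed

text \<open>
  Around a real centre \<open>R > 0\<close> the factor \<open>exp (-R X)\<close> may be split off: the remaining exponential series in
  \<open>\<tau> - R\<close> is dominated termwise by \<open>\<bar>f\<bar>\<close> as long as \<open>\<bar>\<tau> - R\<bar> < R\<close>, so the transform is a power
  series on the disc of radius \<open>R\<close> about \<open>R\<close>. These discs exhaust the open right half-plane.
\<close>
lemma laplace_holomorphic:
  fixes f :: "'a \<Rightarrow> complex" and X :: "'a \<Rightarrow> real"
  assumes f: "integrable M f" and X[measurable]: "X \<in> borel_measurable M"
    and X_nonneg: "\<And>x. x \<in> space M \<Longrightarrow> X x \<ge> 0"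
  shows "(\<lambda>\<tau>. \<integral>x. f x * exp (- \<tau> * of_real (X x)) \<partial>M) holomorphic_on {\<tau>. Re \<tau> > 0}"
proof -
  note [measurable] = borel_measurable_integrable[OF f]
  have "(\<lambda>\<tau>. \<integral>x. f x * exp (- \<tau> * of_real (X x)) \<partial>M) holomorphic_on ball (of_real R) R"
    if R: "R > 0" for R :: real
  proof (rule power_series_holomorphic)
    fix \<tau> assume \<tau>: "\<tau> \<in> ball (complex_of_real R) R"
    define h where "h = \<tau> - of_real R"
    have h: "norm h < R"
      using \<tau> by (simp add: h_def dist_norm norm_minus_commute)
    define g where "g j x = f x * exp (- of_real (R * X x)) * ((- h * of_real (X x)) ^ j / fact j)"
      for j x
    have [measurable]: "g j \<in> borel_measurable M" for j
      unfolding g_def by measurable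
    have norm_g: "norm (g j x) = norm (f x) * exp (- R * X x) * ((norm h * X x) ^ j /\<^sub>R fact j)"
      if "x \<in> space M" for j x
      using X_nonneg[OF that] by (simp add: g_def norm_mult norm_divide norm_power norm_inverse norm_fact divide_inverse)
    have sums_g: "(\<lambda>j. g j x) sums (f x * exp (- \<tau> * of_real (X x)))" for x
    proof -
      have "(\<lambda>j. (- h * of_real (X x)) ^ j /\<^sub>R fact j) sums exp (- h * of_real (X x))"
        by (rule exp_converges)
      then have "(\<lambda>j. (- h * of_real (X x)) ^ j / fact j) sums exp (- h * of_real (X x))"
        by (simp add: scaleR_conv_of_real divide_inverse mult.commute)
      then have "(\<lambda>j. f x * exp (- of_real (R * X x)) * ((- h * of_real (X x)) ^ j / fact j)) sums
           (f x * exp (- of_real (R * X x)) * exp (- h * of_real (X x)))"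
        by (rule sums_mult)
      also have "f x * exp (- of_real (R * X x)) * exp (- h * of_real (X x)) =
          f x * exp (- \<tau> * of_real (X x))"
        unfolding mult.assoc exp_add[symmetric] by (simp add: h_def algebra_simps)
      finally show ?thesis
        by (simp add: g_def)
    qed
    have sums_norm_g: "(\<lambda>j. norm (g j x)) sums (norm (f x) * exp (- (R - norm h) * X x))"
      if "x \<in> space M" for x
    proof -
      have "(\<lambda>j. norm (f x) * exp (- R * X x) * ((norm h * X x) ^ j /\<^sub>R fact j)) sums
           (norm (f x) * exp (- R * X x) * exp (norm h * X x))"
        by (intro sums_mult exp_converges)
      also have "norm (f x) * exp (- R * X x) * exp (norm h * X x) =
          norm (f x) * exp (- (R - norm h) * X x)"
        unfolding mult.assoc exp_add[symmetric] by (simp add: algebra_simps)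
      finally show ?thesis
        using norm_g[OF that] by simp
    qed
    have partial_le: "(\<Sum>j<N. norm (g j x)) \<le> norm (f x)" if "x \<in> space M" for N x
    proof -
      have "(\<Sum>j<N. norm (g j x)) \<le> norm (f x) * exp (- (R - norm h) * X x)"
        using sums_norm_g[OF that] sum_le_suminf[of "\<lambda>j. norm (g j x)" "{..<N}"]
        by (auto simp: sums_iff)
      also have "\<dots> \<le> norm (f x) * 1"
        using h X_nonneg[OF that] by (intro mult_left_mono) (auto simp: mult_nonpos_nonneg)
      finally show ?thesis by simp
    qed
    have int_g: "integrable M (g j)" for j
    proof (rule Bochner_Integration.integrable_bound[OF f])
      show "AE x in M. norm (g j x) \<le> norm (f x)"
      proof (rule AE_I2)
        fix x assume x: "x \<in> space M"
        have "norm (g j x) \<le> (\<Sum>j<Suc j. norm (g j x))"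
          by (rule member_le_sum) auto
        with partial_le[OF x, of "Suc j"] show "norm (g j x) \<le> norm (f x)" by linarith
      qed
    qed measurable
    have "summable (\<lambda>j. \<integral>x. norm (g j x) \<partial>M)"
    proof (rule summableI_nonneg_bounded)
      fix N
      have "(\<Sum>j<N. \<integral>x. norm (g j x) \<partial>M) = (\<integral>x. (\<Sum>j<N. norm (g j x)) \<partial>M)"
        using int_g by (subst Bochner_Integration.integral_sum) auto
      also have "\<dots> \<le> (\<integral>x. norm (f x) \<partial>M)"
        using int_g f partial_le by (intro integral_mono) auto
      finally show "(\<Sum>j<N. \<integral>x. norm (g j x) \<partial>M) \<le> (\<integral>x. norm (f x) \<partial>M)" .
    qed auto
    then have "(\<lambda>j. integral\<^sup>L M (g j)) sums (\<integral>x. (\<Sum>j. g j x) \<partial>M)"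
      using int_g sums_norm_g by (intro sums_integral) (auto simp: sums_iff)
    also have "(\<integral>x. (\<Sum>j. g j x) \<partial>M) = (\<integral>x. f x * exp (- \<tau> * of_real (X x)) \<partial>M)"
      using sums_g by (intro Bochner_Integration.integral_cong) (auto simp: sums_iff)
    moreover have "integral\<^sup>L M (g j) =
        (\<integral>x. f x * exp (- of_real (R * X x)) * ((- of_real (X x)) ^ j / fact j) \<partial>M) * h ^ j" for j
    proof -
      have "g j x = f x * exp (- of_real (R * X x)) * ((- of_real (X x)) ^ j / fact j) * h ^ j" for x
        using power_mult_distrib[of h "- of_real (X x)" j] by (simp add: g_def)
      then have "g j = (\<lambda>x. f x * exp (- of_real (R * X x)) * ((- of_real (X x)) ^ j / fact j) * h ^ j)"
        by (rule ext)
      then show ?thesis by (simp only: integral_mult_left_zero)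
    qed
    ultimately show "(\<lambda>j. (\<integral>x. f x * exp (- of_real (R * X x)) * ((- of_real (X x)) ^ j / fact j) \<partial>M)
        * (\<tau> - of_real R) ^ j) sums (\<integral>x. f x * exp (- \<tau> * of_real (X x)) \<partial>M)"
      by (simp add: h_def)
  qed
  then have "(\<lambda>\<tau>. \<integral>x. f x * exp (- \<tau> * of_real (X x)) \<partial>M)
      holomorphic_on (\<Union>R\<in>{0<..}. ball (of_real R) R)"
    by (intro holomorphic_on_UN_open) auto
  moreover have "{\<tau>. Re \<tau> > 0} \<subseteq> (\<Union>R\<in>{0<..}. ball (complex_of_real R) R)"
  proof
    fix \<tau> :: complex assume "\<tau> \<in> {\<tau>. Re \<tau> > 0}"
    then have \<tau>: "Re \<tau> > 0" by simp
    \<comment> \<open>The circle about \<open>R\<close> through 0 contains \<open>\<tau>\<close> in its interior as soon as \<open>2 R Re \<tau> > \<bar>\<tau>\<bar>\<^sup>2\<close>.\<close>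
    define R where "R = (norm \<tau>)\<^sup>2 / Re \<tau>"
    have R: "R > 0"
      using \<tau> by (auto simp: R_def intro!: divide_pos_pos)
    have "(norm (of_real R - \<tau>))\<^sup>2 = R\<^sup>2 - 2 * (R * Re \<tau>) + (norm \<tau>)\<^sup>2"
      unfolding cmod_power2 by (simp add: power2_eq_square algebra_simps)
    also have "R * Re \<tau> = (norm \<tau>)\<^sup>2"
      using \<tau> by (simp add: R_def)
    also have "R\<^sup>2 - 2 * (norm \<tau>)\<^sup>2 + (norm \<tau>)\<^sup>2 < R\<^sup>2"
      using \<tau> by auto
    finally have "norm (of_real R - \<tau>) < R"
      using R by (simp add: power2_less_imp_less)
    then show "\<tau> \<in> (\<Union>R\<in>{0<..}. ball (complex_of_real R) R)"
      using R by (auto simp: dist_norm)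
  qed
  ultimately show ?thesis
    by (rule holomorphic_on_subset)
qed

text \<open>
  The formula extends from real to complex \<open>p\<close> by analytic continuation. A damping factor
  \<open>exp (- \<delta> x)\<close> with \<open>\<delta> = Re p / 2\<close> is split off, which turns the left-hand side into the Laplace
  transform of an integrable function evaluated at \<open>p - \<delta>\<close>, still in the right half-plane.
\<close>
lemma Gamma_laplace_complex:
  fixes b :: real and p :: complex
  assumes b: "b > -1" and p: "Re p > 0"
  shows "integrable (lebesgue_on {0<..}) (\<lambda>x. of_real (x powr b) * exp (- p * of_real x))"
    and "(\<integral>x. of_real (x powr b) * exp (- p * of_real x) \<partial>lebesgue_on {0<..}) =
      of_real (Gamma (1 + b)) * p powr of_real (-1 - b)"
proof -
  have int: "integrable (lebesgue_on {0<..}) (\<lambda>x. of_real (x powr b) * exp (- q * of_real x))"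
    if "Re q > 0" for q
  proof (rule Bochner_Integration.integrable_bound[OF Gamma_laplace_real(1)[OF b that]])
    have "continuous_on {0<..} (\<lambda>x. of_real (x powr b) * exp (- q * of_real x))"
      by (intro continuous_intros) auto
    then show "(\<lambda>x. of_real (x powr b) * exp (- q * of_real x))
        \<in> borel_measurable (lebesgue_on {0<..})"
      by (intro continuous_imp_measurable_on_sets_lebesgue) auto
  qed (auto simp: norm_mult)
  from int[OF p] show "integrable (lebesgue_on {0<..})
      (\<lambda>x. of_real (x powr b) * exp (- p * of_real x))" .
  define \<delta> where "\<delta> = Re p / 2"
  have \<delta>: "\<delta> > 0" using p by (simp add: \<delta>_def)
  define J where "J \<tau> = (\<integral>x. of_real (x powr b) * exp (- of_real \<delta> * of_real x) *
      exp (- \<tau> * of_real x) \<partial>lebesgue_on {0<..})" for \<tau> :: complex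
  define K where "K \<tau> = of_real (Gamma (1 + b)) * (of_real \<delta> + \<tau>) powr of_real (-1 - b)"
    for \<tau> :: complex
  have hol_J: "J holomorphic_on {\<tau>. Re \<tau> > 0}"
    unfolding J_def using int[of "of_real \<delta>"] \<delta> 
    by (intro laplace_holomorphic continuous_imp_measurable_on_sets_lebesgue)
       (auto simp: space_restrict_space)
  have hol_K: "K holomorphic_on {\<tau>. Re \<tau> > 0}"
    unfolding K_def using \<delta> 
    by (intro holomorphic_intros) (auto simp: complex_nonpos_Reals_iff)
  have J_eq: "J \<tau> = (\<integral>x. of_real (x powr b) * exp (- (of_real \<delta> + \<tau>) * of_real x)
      \<partial>lebesgue_on {0<..})" for \<tau>
    unfolding J_def mult.assoc exp_add[symmetric] by (simp add: algebra_simps)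
  have "J (p - of_real \<delta>) - K (p - of_real \<delta>) = 0"
  proof (rule analytic_continuation[where f = "\<lambda>\<tau>. J \<tau> - K \<tau>" and S = "{\<tau>. Re \<tau> > 0}"
        and U = "of_real ` {0<..}" and \<xi> = 1])
    show "(\<lambda>\<tau>. J \<tau> - K \<tau>) holomorphic_on {\<tau>. Re \<tau> > 0}"
      by (intro holomorphic_intros hol_J hol_K)
    show "open {\<tau>. Re \<tau> > 0}" by (rule open_halfspace_Re_gt)
    show "connected {\<tau>. Re \<tau> > 0}" by (intro convex_connected convex_halfspace_Re_gt)
    show "1 islimpt (complex_of_real ` {0<..})"
      unfolding islimpt_approachable
    proof safe
      fix e :: real assume "e > 0"
      then show "\<exists>x'\<in>complex_of_real ` {0<..}. x' \<noteq> 1 \<and> dist x' 1 < e"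
        by (intro bexI[of _ "of_real (1 + e / 2)"] imageI) (auto simp: dist_norm)
    qed
    fix \<tau> :: complex assume "\<tau> \<in> of_real ` {0<..}"
    then obtain t where t: "t > 0" "\<tau> = of_real t" by auto
    have "J \<tau> = (\<integral>x. of_real (x powr b * exp (- (\<delta> + t) * x)) \<partial>lebesgue_on {0<..})"
      unfolding J_eq t by (simp add: exp_of_real[symmetric])
    also have "\<dots> = of_real (Gamma (1 + b) * (\<delta> + t) powr (-1 - b))"
      using t \<delta> by (subst integral_complex_of_real, subst Gamma_laplace_real(2)) (use b in auto)
    also have "\<dots> = K \<tau>"
      unfolding K_def t using t \<delta>  by (simp flip: powr_of_real)
    finally show "J \<tau> - K \<tau> = 0" by simp
  qed (use p in \<open>auto simp: \<delta>_def\<close>)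
  then have "J (p - of_real \<delta>) = K (p - of_real \<delta>)" by simp
  then show "(\<integral>x. of_real (x powr b) * exp (- p * of_real x) \<partial>lebesgue_on {0<..}) =
      of_real (Gamma (1 + b)) * p powr of_real (-1 - b)"
    unfolding J_eq K_def by simp
qed

section \<open>Laplace transforms of series of powers\<close>

text \<open>
  Restricting the Gamma integral to \<open>t \<ge> x\<close>, where \<open>t powr b \<ge> x powr b\<close>, leaves
  \<open>x powr b * exp (- x)\<close>. The estimate is uniform in \<open>b\<close>; this is what makes a
  series \<open>\<Sum>j. c j * x powr b j\<close> converge, and grow at most exponentially, once
  \<open>\<bar>c j\<bar> * Gamma (1 + b j)\<close> is summable.
\<close>
lemma powr_le_exp_times_Gamma:
  fixes x b :: real
  assumes "x > 0" "b \<ge> 0"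
  shows "x powr b \<le> exp x * Gamma (1 + b)"
proof -
  have "((\<lambda>t. x powr b * exp (- 1 * t)) has_integral (x powr b * (exp (- 1 * x) / 1))) {x..}"
    by (intro has_integral_mult_right has_integral_exp_minus_to_infinity) auto
  then have "((\<lambda>t. if t \<in> {x..} then x powr b * exp (- 1 * t) else 0)
      has_integral (x powr b * (exp (- 1 * x) / 1))) {0..}"
    using assms by (subst has_integral_restrict) auto
  moreover have "((\<lambda>t. t powr (1 + b - 1) / exp t) has_integral Gamma (1 + b)) {0..}"
    by (rule Gamma_integral_real) (use assms in auto)
  ultimately have "x powr b * (exp (- 1 * x) / 1) \<le> Gamma (1 + b)"
    by (rule has_integral_le)
       (use assms in \<open>auto simp: exp_minus divide_inverse intro!: mult_right_mono powr_mono2\<close>)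
  then show ?thesis
    by (simp add: exp_minus field_simps)
qed

lemma summable_laplace_series:
  fixes c :: "nat \<Rightarrow> complex" and b :: "nat \<Rightarrow> real"
  assumes b: "\<And>j. b j \<ge> 0" and \<sigma>: "\<sigma> > 0"
    and summable: "summable (\<lambda>j. norm (c j) * Gamma (1 + b j) * \<sigma> powr (-1 - b j))"
    and x: "x > 0"
  shows "summable (\<lambda>j. norm (c j * of_real (x powr b j)))"
proof (rule summable_comparison_test'[of _ 0])
  show "summable (\<lambda>j. norm (c j) * Gamma (1 + b j) * \<sigma> powr (-1 - b j) * (\<sigma> * exp (\<sigma> * x)))"
    using summable by (rule summable_mult2)
  fix j
  have "x powr b j = \<sigma> powr (- b j) * (\<sigma> * x) powr b j"
    using x \<sigma> by (simp add: powr_mult powr_minus field_simps)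
  also have "\<dots> \<le> \<sigma> powr (- b j) * (exp (\<sigma> * x) * Gamma (1 + b j))"
    using x \<sigma> b by (intro mult_left_mono powr_le_exp_times_Gamma) auto
  finally have "norm (c j) * x powr b j \<le>
      norm (c j) * (\<sigma> powr (- b j) * (exp (\<sigma> * x) * Gamma (1 + b j)))"
    by (rule mult_left_mono) auto
  also have "\<sigma> powr (- b j) = \<sigma> powr (-1 - b j) * \<sigma>"
    using \<sigma> by (simp add: powr_diff powr_minus field_simps)
  finally show "norm (norm (c j * complex_of_real (x powr b j))) \<le>
      norm (c j) * Gamma (1 + b j) * \<sigma> powr (-1 - b j) * (\<sigma> * exp (\<sigma> * x))"
    by (simp add: norm_mult mult_ac)
qed

text \<open>
  The hypothesis is summability of the integrals of the absolute values, so that the Laplace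
  transform may be taken term by term.
\<close>
lemma laplace_series:
  fixes c :: "nat \<Rightarrow> complex" and b :: "nat \<Rightarrow> real" and p :: complex
  assumes b: "\<And>j. b j \<ge> 0" and p: "Re p > 0"
    and summable: "summable (\<lambda>j. norm (c j) * Gamma (1 + b j) * Re p powr (-1 - b j))"
  shows "integrable (lebesgue_on {0<..})
      (\<lambda>x. (\<Sum>j. c j * of_real (x powr b j)) * exp (- p * of_real x))" (is ?int)
    and "(\<lambda>j. c j * of_real (Gamma (1 + b j)) * p powr of_real (-1 - b j)) sums
      (\<integral>x. (\<Sum>j. c j * of_real (x powr b j)) * exp (- p * of_real x) \<partial>lebesgue_on {0<..})"
      (is ?sums)
proof -
  define f where "f j x = c j * (of_real (x powr b j) * exp (- p * of_real x))" for j x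
  have b': "b j > -1" for j using b[of j] by linarith
  have int: "integrable (lebesgue_on {0<..}) (f j)" for j
    unfolding f_def by (intro integrable_mult_right Gamma_laplace_complex(1) b' p)
  have integral_f: "integral\<^sup>L (lebesgue_on {0<..}) (f j) =
      c j * of_real (Gamma (1 + b j)) * p powr of_real (-1 - b j)" for j
    unfolding f_def by (subst integral_mult_right_zero) (simp only: Gamma_laplace_complex(2)[OF b' p] mult.assoc)
  have norm_f: "norm (f j x) = norm (c j) * (x powr b j * exp (- Re p * x))" for j x
    by (simp add: f_def norm_mult)
  have integral_norm_f: "(\<integral>x. norm (f j x) \<partial>lebesgue_on {0<..}) =
      norm (c j) * Gamma (1 + b j) * Re p powr (-1 - b j)" for j
    unfolding norm_f
    by (subst integral_mult_right_zero) (simp only: Gamma_laplace_real(2)[OF b' p] mult.assoc)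
  note summable_c = summable_laplace_series[OF b p summable]
  have f_mult: "f j x = c j * of_real (x powr b j) * exp (- p * of_real x)" for j x
    by (simp add: f_def mult_ac)
  have AE: "AE x in lebesgue_on {0<..}. summable (\<lambda>j. norm (f j x))"
    unfolding f_mult norm_mult[of _ "exp _"]
    by (intro AE_I2 summable_mult2 summable_c) (auto simp: space_restrict_space)
  have suminf_f: "(\<Sum>j. f j x) = (\<Sum>j. c j * of_real (x powr b j)) * exp (- p * of_real x)"
    if "x \<in> space (lebesgue_on {0<..})" for x
    unfolding f_mult using that
    by (intro suminf_mult2[symmetric] summable_norm_cancel[OF summable_c]) (auto simp: space_restrict_space)
  have sums: "summable (\<lambda>j. \<integral>x. norm (f j x) \<partial>lebesgue_on {0<..})"
    unfolding integral_norm_f by (rule summable)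
  have "integrable (lebesgue_on {0<..}) (\<lambda>x. \<Sum>j. f j x) = ?int"
    by (rule Bochner_Integration.integrable_cong[OF refl suminf_f])
  then show ?int
    using integrable_suminf[OF int AE sums] by blast
  have "(\<integral>x. (\<Sum>j. f j x) \<partial>lebesgue_on {0<..}) =
      (\<integral>x. (\<Sum>j. c j * of_real (x powr b j)) * exp (- p * of_real x) \<partial>lebesgue_on {0<..})"
    by (rule Bochner_Integration.integral_cong[OF refl suminf_f])
  then show ?sums
    using sums_integral[OF int AE sums] unfolding integral_f by (simp only:)
qed

text \<open>
  Here the ray may be so oblique that \<open>Re p\<close> is small, and the integrals of the absolute values of the
  terms need not be summable; only the sum is known to be integrable. The termwise formula
  nevertheless persists. Damping by \<open>exp (- \<tau> x)\<close> gives a transform \<open>J\<close> holomorphic for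
  \<open>Re \<tau> > 0\<close>. For \<open>Re \<tau> > 1\<close> the terms may be integrated one by one and \<open>J\<close> equals the series
  \<open>K\<close> of their transforms. Since \<open>\<bar>p\<bar> = 1\<close>, the terms of \<open>K\<close> are bounded by a fixed summable
  sequence wherever \<open>\<bar>p + \<tau>\<bar> \<ge> 1\<close>, in particular where \<open>p \<bullet> \<tau> \<ge> 0\<close>. So \<open>J = K\<close> on the
  intersection of two half-planes, and \<open>\<tau> \<rightarrow> 0\<close> along the positive reals gives the claim, by dominated
  convergence for \<open>J\<close> and continuity for \<open>K\<close>.
\<close>
lemma laplace_series_of_integrable:
  fixes c :: "nat \<Rightarrow> complex" and b :: "nat \<Rightarrow> real" and p :: complex
  assumes b: "\<And>j. b j \<ge> 0" and p: "Re p > 0" "norm p = 1"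
    and summable: "summable (\<lambda>j. norm (c j) * Gamma (1 + b j))"
    and int: "integrable (lebesgue_on {0<..})
      (\<lambda>x. (\<Sum>j. c j * of_real (x powr b j)) * exp (- p * of_real x))"
  shows "(\<lambda>j. c j * of_real (Gamma (1 + b j)) * p powr of_real (-1 - b j)) sums
      (\<integral>x. (\<Sum>j. c j * of_real (x powr b j)) * exp (- p * of_real x) \<partial>lebesgue_on {0<..})"
proof -
  define F where "F x = (\<Sum>j. c j * of_real (x powr b j)) * exp (- p * of_real x)" for x
  define J where "J \<tau> = (\<integral>x. F x * exp (- \<tau> * of_real x) \<partial>lebesgue_on {0<..})" for \<tau> :: complex
  define f where "f j \<tau> = c j * of_real (Gamma (1 + b j)) * (p + \<tau>) powr of_real (-1 - b j)"
    for j and \<tau> :: complex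
  define K where "K \<tau> = (\<Sum>j. f j \<tau>)" for \<tau>
  \<comment> \<open>On the closed region \<open>T\<close> the series is controlled up to \<open>\<tau> = 0\<close>; on its interior \<open>S\<close>
    both functions are holomorphic. \<open>S\<close> is convex, which provides the connectedness for continuation.\<close>
  define S where "S = {\<tau>. Re \<tau> > 0} \<inter> {\<tau>. p \<bullet> \<tau> > 0}"
  define T where "T = {\<tau>. Re \<tau> \<ge> 0 \<and> p \<bullet> \<tau> \<ge> 0}"
  have int_F: "integrable (lebesgue_on {0<..}) F"
    using int by (simp add: F_def[abs_def])
  note [measurable] = borel_measurable_integrable[OF int_F]
  have id_meas[measurable]: "(\<lambda>x::real. x) \<in> borel_measurable (lebesgue_on {0<..})"
    by (intro continuous_imp_measurable_on_sets_lebesgue) auto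
  have S_T: "S \<subseteq> T"
    by (auto simp: S_def T_def)
  have norm_ge: "norm (p + \<tau>) \<ge> 1" if "\<tau> \<in> T" for \<tau>
  proof -
    have "(norm (p + \<tau>))\<^sup>2 = (norm p)\<^sup>2 + 2 * (p \<bullet> \<tau>) + (norm \<tau>)\<^sup>2"
      by (simp add: power2_norm_eq_inner inner_add_left inner_add_right inner_commute)
    also have "\<dots> \<ge> 1\<^sup>2"
      using that p by (simp add: T_def)
    finally show ?thesis
      by (rule power2_le_imp_le) auto
  qed
  have norm_f: "norm (f j \<tau>) \<le> norm (c j) * Gamma (1 + b j)" if "\<tau> \<in> T" for j \<tau>
  proof -
    have "norm (p + \<tau>) powr (-1 - b j) \<le> norm (p + \<tau>) powr 0"
      using norm_ge[OF that] b[of j] by (intro powr_mono) auto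
    also have "\<dots> = 1"
      using norm_ge[OF that] by auto
    finally have "norm ((p + \<tau>) powr of_real (-1 - b j)) \<le> 1"
      by (subst norm_powr_real_powr') auto
    moreover have "Gamma (1 + b j) > 0"
      using b[of j] by (intro Gamma_real_pos) auto
    ultimately show ?thesis
      by (simp add: f_def norm_mult mult_left_le)
  qed
  have unif: "uniform_limit T (\<lambda>n \<tau>. \<Sum>j<n. f j \<tau>) K sequentially"
    unfolding K_def by (rule Weierstrass_m_test[OF norm_f summable])
  have sums_K: "(\<lambda>j. f j \<tau>) sums K \<tau>" if "\<tau> \<in> T" for \<tau>
    using tendsto_uniform_limitI[OF unif that] by (simp add: sums_def)
  have f_hol: "f j holomorphic_on {\<tau>. Re \<tau> > - Re p}" for j
    unfolding f_def by (intro holomorphic_intros) (auto simp: complex_nonpos_Reals_iff)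
  have T_sub: "T \<subseteq> {\<tau>. Re \<tau> > - Re p}"
    using p by (auto simp: T_def)
  have open_S: "open S"
    unfolding S_def by (intro open_Int open_halfspace_Re_gt open_halfspace_gt)
  have hol_K: "K holomorphic_on S"
  proof (rule holomorphic_uniform_sequence[OF open_S])
    show "(\<lambda>\<tau>. \<Sum>j<n. f j \<tau>) holomorphic_on S" for n
      using S_T T_sub by (intro holomorphic_intros holomorphic_on_subset[OF f_hol]) auto
    fix x assume "x \<in> S"
    with open_S obtain d where "d > 0" "cball x d \<subseteq> S"
      by (meson open_contains_cball)
    then show "\<exists>d>0. cball x d \<subseteq> S \<and>
        uniform_limit (cball x d) (\<lambda>n \<tau>. \<Sum>j<n. f j \<tau>) K sequentially"
      using S_T uniform_limit_on_subset[OF unif] by blast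
  qed
  have cont_K: "continuous_on T K"
  proof (rule uniform_limit_theorem[OF _ unif])
    have "(\<lambda>\<tau>. \<Sum>j<N. f j \<tau>) holomorphic_on T" for N
      by (intro holomorphic_intros holomorphic_on_subset[OF f_hol T_sub])
    then show "\<forall>\<^sub>F N in sequentially. continuous_on T (\<lambda>\<tau>. \<Sum>j<N. f j \<tau>)"
      by (intro always_eventually allI holomorphic_on_imp_continuous_on)
  qed auto
  have hol_J: "J holomorphic_on S"
    unfolding J_def
    by (rule holomorphic_on_subset[OF laplace_holomorphic[OF int_F id_meas]])
       (auto simp: S_def space_restrict_space)
  have J_eq_K: "J \<tau> = K \<tau>" if "\<tau> \<in> S" for \<tau>
  proof (rule analytic_continuation_open[OF _ open_S _ _ _ hol_J hol_K _ that])
    show "open (S \<inter> {\<tau>. Re \<tau> > 1})"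
      by (intro open_Int open_S open_halfspace_Re_gt)
    have "2 \<in> S \<inter> {\<tau>. Re \<tau> > 1}"
      using p by (simp add: S_def inner_complex_def)
    then show "S \<inter> {\<tau>. Re \<tau> > 1} \<noteq> {}" by blast
    show "connected S"
      unfolding S_def by (intro convex_connected convex_Int convex_halfspace_Re_gt convex_halfspace_gt)
    fix \<tau> assume \<tau>: "\<tau> \<in> S \<inter> {\<tau>. Re \<tau> > 1}"
    then have Re: "Re (p + \<tau>) \<ge> 1" using p by auto
    have "summable (\<lambda>j. norm (c j) * Gamma (1 + b j) * Re (p + \<tau>) powr (-1 - b j))"
    proof (rule summable_comparison_test'[OF summable, of 0])
      fix j
      have "Re (p + \<tau>) powr (-1 - b j) \<le> Re (p + \<tau>) powr 0"
        using Re b[of j] by (intro powr_mono) auto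
      also have "\<dots> = 1"
        using Re by auto
      finally have "Re (p + \<tau>) powr (-1 - b j) \<le> 1" .
      moreover have "Gamma (1 + b j) > 0"
        using b[of j] by (intro Gamma_real_pos) auto
      ultimately show "norm (norm (c j) * Gamma (1 + b j) * Re (p + \<tau>) powr (-1 - b j)) \<le>
          norm (c j) * Gamma (1 + b j)"
        by (simp add: abs_mult mult_left_le)
    qed
    from laplace_series(2)[OF b _ this] Re
    have "(\<lambda>j. f j \<tau>) sums (\<integral>x. (\<Sum>j. c j * of_real (x powr b j)) * exp (- (p + \<tau>) * of_real x)
        \<partial>lebesgue_on {0<..})"
      by (simp add: f_def)
    moreover have "(\<Sum>j. c j * of_real (x powr b j)) * exp (- (p + \<tau>) * of_real x) =
        F x * exp (- \<tau> * of_real x)" for x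
      unfolding F_def mult.assoc exp_add[symmetric] by (simp add: algebra_simps)
    ultimately have "(\<lambda>j. f j \<tau>) sums J \<tau>"
      by (simp only: J_def)
    moreover have "(\<lambda>j. f j \<tau>) sums K \<tau>"
      using \<tau> S_T by (intro sums_K) auto
    ultimately show "J \<tau> = K \<tau>"
      by (rule sums_unique2)
  qed auto
  define t where "t n = inverse (real (Suc n))" for n
  have t_S: "of_real (t n) \<in> S" for n
    using p by (simp add: S_def inner_complex_def t_def)
  have t_lim: "t \<longlonglongrightarrow> 0"
    unfolding t_def by (rule LIMSEQ_inverse_real_of_nat)
  have "(\<lambda>n. J (of_real (t n))) \<longlonglongrightarrow> (\<integral>x. F x \<partial>lebesgue_on {0<..})"
    unfolding J_def
  proof (rule integral_dominated_convergence)
    show "integrable (lebesgue_on {0<..}) (\<lambda>x. norm (F x))"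
      using int_F by simp
    show "AE x in lebesgue_on {0<..}.
        (\<lambda>n. F x * exp (- complex_of_real (t n) * complex_of_real x)) \<longlonglongrightarrow> F x"
    proof (rule AE_I2)
      fix x :: real
      have "(\<lambda>n. F x * exp (- complex_of_real (t n) * complex_of_real x))
          \<longlonglongrightarrow> F x * exp (- complex_of_real 0 * complex_of_real x)"
        by (intro tendsto_intros t_lim)
      then show "(\<lambda>n. F x * exp (- complex_of_real (t n) * complex_of_real x)) \<longlonglongrightarrow> F x"
        by simp
    qed
    show "AE x in lebesgue_on {0<..}.
        norm (F x * exp (- complex_of_real (t n) * complex_of_real x)) \<le> norm (F x)" for n
      by (rule AE_I2) (auto simp: norm_mult space_restrict_space t_def mult_left_le)
  qed measurable
  moreover have "(\<lambda>n. K (of_real (t n))) \<longlonglongrightarrow> K 0"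
  proof (rule continuous_on_tendsto_compose[OF cont_K])
    show "(\<lambda>n. complex_of_real (t n)) \<longlonglongrightarrow> 0"
      using tendsto_of_real[OF t_lim, where 'a = complex] by simp
    show "\<forall>\<^sub>F n in sequentially. of_real (t n) \<in> T"
      using t_S S_T by (intro always_eventually) blast
  qed (simp add: T_def)
  ultimately have "(\<integral>x. F x \<partial>lebesgue_on {0<..}) = K 0"
    using J_eq_K[OF t_S] by (simp add: LIMSEQ_unique)
  moreover have "(\<lambda>j. f j 0) sums K 0"
    by (rule sums_K) (simp add: T_def)
  ultimately show ?thesis
    by (simp add: F_def f_def)
qed

section \<open>Growth of quotients of moments\<close>

text \<open>
  Termwise differentiation of a power series multiplies its coefficients by the index, which raises
  the exponent \<open>K\<close> by one.
\<close>
lemma summable_power_times_geometric: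
  fixes x :: real
  assumes "0 \<le> x" "x < 1"
  shows "summable (\<lambda>j. real (Suc j) ^ K * x ^ j)"
  using assms
proof (induction K arbitrary: x)
  case 0
  then show ?case by (simp add: summable_geometric)
next
  case (Suc K)
  have "summable (\<lambda>j. diffs (\<lambda>j. real (Suc j) ^ K) j * x ^ j)"
  proof (rule termdiff_converges[of _ 1])
    fix y :: real assume "norm y < 1"
    then have "summable (\<lambda>j. real (Suc j) ^ K * \<bar>y\<bar> ^ j)"
      by (intro Suc.IH) auto
    then have "summable (\<lambda>j. norm (real (Suc j) ^ K * y ^ j))"
      by (simp add: abs_mult power_abs)
    then show "summable (\<lambda>j. real (Suc j) ^ K * y ^ j)"
      by (rule summable_norm_cancel)
  qed (use Suc.prems in auto)
  then show ?case
  proof (rule summable_comparison_test'[of _ 0])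
    fix j
    have "real (Suc j) ^ K \<le> real (Suc (Suc j)) ^ K"
      by (intro power_mono) auto
    then have "real (Suc j) * real (Suc j) ^ K * x ^ j \<le> real (Suc j) * real (Suc (Suc j)) ^ K * x ^ j"
      using Suc.prems by (intro mult_right_mono mult_left_mono) auto
    then show "norm (real (Suc j) ^ Suc K * x ^ j) \<le> diffs (\<lambda>j. real (Suc j) ^ K) j * x ^ j"
      using Suc.prems by (simp add: diffs_def)
  qed
qed

text \<open>
  Under the Gamma integral, \<open>t powr \<beta> \<le> 1 + t powr K\<close> for \<open>0 \<le> \<beta> \<le> K\<close>. An integer shift of Gamma
  is a Pochhammer symbol, so a fixed real shift costs at most a polynomial factor in \<open>y\<close>.
\<close>
lemma Gamma_shift_le:
  fixes y \<beta> :: real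
  assumes "y \<ge> 0" "0 \<le> \<beta>" "\<beta> \<le> real K"
  shows "Gamma (1 + y + \<beta>) \<le> Gamma (1 + y) * (1 + pochhammer (1 + y) K)"
proof -
  have G1: "integrable (lebesgue_on {0<..}) (\<lambda>t. t powr b * exp (- 1 * t))"
    and G2: "(\<integral>t. t powr b * exp (- 1 * t) \<partial>lebesgue_on {0<..}) = Gamma (1 + b)"
    if "b \<ge> 0" for b :: real
    using Gamma_laplace_real[of b 1] that by auto
  have "Gamma (1 + (y + \<beta>)) = (\<integral>t. t powr (y + \<beta>) * exp (- 1 * t) \<partial>lebesgue_on {0<..})"
    using assms by (intro G2[symmetric]) auto
  also have "\<dots> \<le> (\<integral>t. t powr y * exp (- 1 * t) + t powr (y + real K) * exp (- 1 * t)
      \<partial>lebesgue_on {0<..})"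
  proof (rule integral_mono)
    fix t :: real assume "t \<in> space (lebesgue_on {0<..})"
    then have t: "t > 0" by (simp add: space_restrict_space)
    have "t powr (y + \<beta>) \<le> t powr y + t powr (y + real K)"
    proof (cases "t \<ge> 1")
      case True
      then have "t powr (y + \<beta>) \<le> t powr (y + real K)" using assms by (intro powr_mono) auto
      then show ?thesis by (simp add: add_increasing)
    next
      case False
      then have "t powr (y + \<beta>) \<le> t powr y" using assms t by (intro powr_mono') auto
      then show ?thesis by (simp add: add_increasing2)
    qed
    then show "t powr (y + \<beta>) * exp (- 1 * t) \<le>
        t powr y * exp (- 1 * t) + t powr (y + real K) * exp (- 1 * t)"
      unfolding distrib_right[symmetric] by (rule mult_right_mono) auto
  qed (intro G1 Bochner_Integration.integrable_add; use assms in simp)+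
  also have "\<dots> = Gamma (1 + y) + Gamma (1 + (y + real K))"
    using assms by (subst Bochner_Integration.integral_add) (auto intro!: G1 simp only: G2)
  also have "Gamma (1 + (y + real K)) = pochhammer (1 + y) K * Gamma (1 + y)"
  proof -
    have "1 + y \<notin> \<int>\<^sub>\<le>\<^sub>0" using assms by (auto elim!: nonpos_Ints_cases)
    moreover have "Gamma (1 + y) > 0" using assms by (intro Gamma_real_pos) auto
    ultimately show ?thesis
      by (subst pochhammer_Gamma) (auto simp: add_ac)
  qed
  finally show ?thesis
    by (simp add: algebra_simps)
qed

lemma summable_Gamma_ratio_geometric:
  fixes s \<beta> x :: real
  assumes "s > 0" "\<beta> \<ge> 0" "0 \<le> x" "x < 1"
  shows "summable (\<lambda>j. Gamma (1 + s * real j + \<beta>) / Gamma (1 + s * real j) * x ^ j)"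
proof -
  obtain K where K: "\<beta> \<le> real K"
    using real_arch_simple by blast
  define C where "C = 1 + s + real K"
  have "summable (\<lambda>j. real (Suc j) ^ 0 * x ^ j + C ^ K * (real (Suc j) ^ K * x ^ j))"
    by (intro summable_add summable_mult summable_power_times_geometric assms)
  then show ?thesis
  proof (rule summable_comparison_test'[of _ 0])
    fix j
    have G: "Gamma (1 + s * real j) > 0" "Gamma (1 + s * real j + \<beta>) > 0"
      using assms by (auto intro!: Gamma_real_pos add_pos_nonneg)
    have "Gamma (1 + s * real j + \<beta>) / Gamma (1 + s * real j) \<le> 1 + pochhammer (1 + s * real j) K"
      using Gamma_shift_le[of "s * real j" \<beta> K] assms K G by (simp add: divide_le_eq mult.commute)
    also have "pochhammer (1 + s * real j) K \<le> (\<Prod>i<K. C * real (Suc j))"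
      unfolding pochhammer_prod lessThan_atLeast0[symmetric]
    proof (rule prod_mono)
      fix i assume i: "i \<in> {..<K}"
      have "1 + s * real j + real i \<le> 1 + s * real j + real K"
        using i by simp
      also have "\<dots> \<le> C * real (Suc j)"
        using assms by (simp add: C_def algebra_simps)
      finally show "0 \<le> 1 + s * real j + of_nat i \<and> 1 + s * real j + of_nat i \<le> C * real (Suc j)"
        using assms by (auto intro!: add_nonneg_nonneg)
    qed
    also have "(\<Prod>i<K. C * real (Suc j)) = C ^ K * real (Suc j) ^ K"
      by (simp add: power_mult_distrib)
    finally have "Gamma (1 + s * real j + \<beta>) / Gamma (1 + s * real j) * x ^ j \<le>
        (1 + C ^ K * real (Suc j) ^ K) * x ^ j"
      using assms by (intro mult_right_mono) auto
    then show "norm (Gamma (1 + s * real j + \<beta>) / Gamma (1 + s * real j) * x ^ j) \<le>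
        real (Suc j) ^ 0 * x ^ j + C ^ K * (real (Suc j) ^ K * x ^ j)"
      using G assms by (simp add: abs_mult algebra_simps)
  qed
qed

lemma generalized_moments_pos:
  assumes "s > 0" "m j > 0"
  shows "generalized_moments s m j > 0"
  using assms by (auto simp: generalized_moments_def Gamma_seq_def
      intro!: mult_pos_pos Gamma_real_pos add_pos_nonneg)

text \<open>
  The Gamma quotient grows polynomially in \<open>j\<close>, and \<open>m j\<close> eventually exceeds \<open>y ^ j\<close> for some \<open>y > q\<close>.
  With \<open>q = \<bar>z\<bar> / \<epsilon>\<close>, with \<open>q\<close> slightly above it, and with \<open>q\<close> enlarged for an oblique direction, this
  is the convergence of the series over the circle, of the moment derivative, and of the ray integrals.
\<close>
lemma summable_generalized_moment_ratio:
  fixes s q :: real and m :: "nat \<Rightarrow> real"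
  assumes s: "s > 0" and m: "\<And>j. m j > 0" and q: "q \<ge> 0"
    and less: "ereal q < liminf (\<lambda>j. ereal (root j (m j)))"
  shows "summable (\<lambda>j. q ^ j * (Gamma (1 + s * real (n + j)) / generalized_moments s m j))"
proof -
  from less obtain y where y: "q < y" "ereal y < liminf (\<lambda>j. ereal (root j (m j)))"
    using ereal_dense2 less_ereal.simps(1) by blast
  have "eventually (\<lambda>j. y < root j (m j)) sequentially"
    using less_LiminfD[OF y(2)] by simp
  then have ev: "eventually (\<lambda>j. y ^ j \<le> m j) sequentially"
    using eventually_gt_at_top[of 0]
  proof eventually_elim
    case (elim j)
    then have "y ^ j \<le> root j (m j) ^ j"
      using y q by (intro power_mono) auto
    also have "\<dots> = m j"
      using elim m[of j] by (simp add: less_imp_le)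
    finally show ?case .
  qed
  have "summable (\<lambda>j. Gamma (1 + s * real j + s * real n) / Gamma (1 + s * real j) * (q / y) ^ j)"
    using s q y by (intro summable_Gamma_ratio_geometric) auto
  then show ?thesis
  proof (rule summable_comparison_test_ev[rotated])
    show "\<forall>\<^sub>F j in sequentially.
        norm (q ^ j * (Gamma (1 + s * real (n + j)) / generalized_moments s m j)) \<le>
        Gamma (1 + s * real j + s * real n) / Gamma (1 + s * real j) * (q / y) ^ j"
      using ev
    proof eventually_elim
      case (elim j)
      have G: "Gamma (1 + s * real j) > 0" "Gamma (1 + s * real j + s * real n) > 0"
        using s by (auto intro!: Gamma_real_pos add_pos_nonneg)
      have "norm (q ^ j * (Gamma (1 + s * real (n + j)) / generalized_moments s m j)) =
          Gamma (1 + s * real j + s * real n) / Gamma (1 + s * real j) * (q ^ j / m j)"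
        using G q m[of j] by (simp add: generalized_moments_def Gamma_seq_def abs_mult algebra_simps)
      also have "\<dots> \<le> Gamma (1 + s * real j + s * real n) / Gamma (1 + s * real j) * (q / y) ^ j"
        unfolding power_divide using G elim y q
        by (intro mult_left_mono divide_left_mono mult_pos_pos m divide_nonneg_nonneg) auto
      finally show ?case .
    qed
  qed
qed

section \<open>The ray integral as a Laplace transform\<close>

lemma set_integrable_lborel_iff_lebesgue_on:
  fixes f :: "real \<Rightarrow> 'a::{banach, second_countable_topology}"
  assumes [measurable]: "f \<in> borel_measurable borel" "S \<in> sets borel"
  shows "set_integrable lborel S f \<longleftrightarrow> integrable (lebesgue_on S) f"
    and "(LINT x:S|lborel. f x) = integral\<^sup>L (lebesgue_on S) f"
proof -
  have S: "S \<in> sets lebesgue" using assms(2) by simp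
  have "(\<lambda>x. indicator S x *\<^sub>R f x) \<in> borel_measurable lborel" by measurable
  then show "set_integrable lborel S f \<longleftrightarrow> integrable (lebesgue_on S) f"
    and "(LINT x:S|lborel. f x) = integral\<^sup>L (lebesgue_on S) f"
    using S by (simp_all add: set_integrable_def set_lebesgue_integral_def integrable_restrict_space
        integral_restrict_space integrable_completion integral_completion)
qed

lemma measurable_moment_exp [measurable]: "moment_exp M \<in> borel_measurable borel"
  unfolding moment_exp_def by measurable

lemma measurable_ray_integrand: "ray_integrand k M n z w \<theta> \<in> borel_measurable borel"
  unfolding ray_integrand_def polar_powr_def Let_def by measurable

text \<open>
  Under the substitution \<open>x = (\<bar>w\<bar> t)\<^sup>k\<close> the ray integrand becomes
  \<open>(\<Sum>j. ray_coeff j * x powr (s (n + j))) * exp (- x cis \<psi>)\<close> with \<open>\<psi> = k (Arg w + \<theta>)\<close>. All constant phases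
  and powers of \<open>\<bar>w\<bar>\<close> are collected in the coefficient.
\<close>
definition ray_coeff ::
  "real \<Rightarrow> (nat \<Rightarrow> real) \<Rightarrow> nat \<Rightarrow> complex \<Rightarrow> complex \<Rightarrow> real \<Rightarrow> nat \<Rightarrow> complex"
  where "ray_coeff k M n z w \<theta> j =
    cis \<theta> * cis ((k - 1) * (Arg w + \<theta>)) / of_real (norm w) *
    ((cis \<theta> / of_real (norm w)) ^ (n + j) * (z ^ j / of_real (M j)))"

lemma norm_ray_coeff:
  assumes "M j > 0"
  shows "norm (ray_coeff k M n z w \<theta> j) = norm z ^ j / (M j * norm w ^ (n + j + 1))"
  using assms by (simp add: ray_coeff_def norm_mult norm_divide norm_power power_divide)

lemma ray_integrand_eq_laplace_integrand:
  assumes s: "s > 0" "k = 1 / s" and w: "w \<noteq> 0" and t: "t > 0"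
    and summable: "summable (\<lambda>j. ray_coeff k M n z w \<theta> j *
      of_real (((norm w * t) powr k) powr (s * real (n + j))))"
  shows "ray_integrand k M n z w \<theta> t =
    \<bar>k * norm w * (norm w * t) powr (k - 1)\<bar> *\<^sub>R
    ((\<Sum>j. ray_coeff k M n z w \<theta> j * of_real (((norm w * t) powr k) powr (s * real (n + j)))) *
     exp (- cis (k * (Arg w + \<theta>)) * of_real ((norm w * t) powr k)))"
proof -
  define \<rho> where "\<rho> = norm w * t"
  define \<psi> where "\<psi> = Arg w + \<theta>"
  define \<zeta> where "\<zeta> = of_real t * cis \<theta>"
  \<comment> \<open>\<open>P\<close> gathers everything in the \<open>j\<close>-th summand that does not depend on \<open>j\<close>; it is nonzero, so the
    summability of the exponential series follows from that of the given series.\<close>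
  define P where "P = cis \<theta> * cis ((k - 1) * \<psi>) / of_real (norm w) * \<zeta> ^ n"
  have \<rho>: "\<rho> > 0" using w t by (simp add: \<rho>_def)
  have k: "k > 0" using s by simp
  have summand: "ray_coeff k M n z w \<theta> j * of_real ((\<rho> powr k) powr (s * real (n + j))) =
      P * ((z * \<zeta>) ^ j / of_real (M j))" for j
  proof -
    have "(\<rho> powr k) powr (s * real (n + j)) = \<rho> ^ (n + j)"
      using s \<rho> by (simp add: powr_powr powr_realpow[symmetric])
    then have "ray_coeff k M n z w \<theta> j * of_real ((\<rho> powr k) powr (s * real (n + j))) =
        cis \<theta> * cis ((k - 1) * \<psi>) / of_real (norm w) *
        (((cis \<theta> / of_real (norm w)) ^ (n + j) * of_real (\<rho> ^ (n + j))) * (z ^ j / of_real (M j)))"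
      unfolding ray_coeff_def \<psi>_def by (simp only: mult_ac)
    also have "(cis \<theta> / of_real (norm w)) ^ (n + j) * of_real (\<rho> ^ (n + j)) = \<zeta> ^ (n + j)"
      unfolding of_real_power power_mult_distrib[symmetric]
      using w by (simp add: \<rho>_def \<zeta>_def mult.commute)
    finally have "ray_coeff k M n z w \<theta> j * of_real ((\<rho> powr k) powr (s * real (n + j))) =
        cis \<theta> * cis ((k - 1) * \<psi>) / of_real (norm w) * (\<zeta> ^ (n + j) * (z ^ j / of_real (M j)))" .
    then show ?thesis
      by (simp add: P_def power_add power_mult_distrib mult_ac)
  qed
  have P: "P \<noteq> 0" using w t by (simp add: P_def \<zeta>_def)
  have "summable (\<lambda>j. P * ((z * \<zeta>) ^ j / of_real (M j)))"
    using summable unfolding \<rho>_def[symmetric] summand .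
  then have "summable (\<lambda>j. (z * \<zeta>) ^ j / of_real (M j))"
    using P by (simp only: summable_cmult_iff) simp
  then have "(\<Sum>j. ray_coeff k M n z w \<theta> j * of_real ((\<rho> powr k) powr (s * real (n + j)))) =
      P * moment_exp M (z * \<zeta>)"
    unfolding summand moment_exp_def by (rule suminf_mult)
  moreover have "\<bar>k * norm w * \<rho> powr (k - 1)\<bar> = k * norm w * \<rho> powr (k - 1)"
    using k by simp
  ultimately show ?thesis
    unfolding ray_integrand_def Let_def \<rho>_def[symmetric] \<psi>_def[symmetric] \<zeta>_def[symmetric]
    using w by (simp add: polar_powr_def P_def scaleR_conv_of_real mult_ac)
qed

text \<open>
  The damping \<open>\<sigma>\<close> is free because the lemma serves both uses of the Laplace series: with
  \<open>\<sigma> = cos (k (Arg w + \<theta>))\<close> for proving convergence of a ray integral, and with \<open>\<sigma> = 1\<close> for evaluating one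
  that is known to converge.
\<close>
lemma ray_substitution:
  fixes M :: "nat \<Rightarrow> real" and \<sigma> :: real
  assumes s: "s > 0" "k = 1 / s" and w: "w \<noteq> 0" and \<sigma>: "\<sigma> > 0"
    and summable: "summable (\<lambda>j. norm (ray_coeff k M n z w \<theta> j) *
      Gamma (1 + s * real (n + j)) * \<sigma> powr (-1 - s * real (n + j)))"
  defines "H \<equiv> (\<lambda>x. (\<Sum>j. ray_coeff k M n z w \<theta> j * of_real (x powr (s * real (n + j)))) *
    exp (- cis (k * (Arg w + \<theta>)) * of_real x))"
  shows "ray_converges k M n z w \<theta> \<longleftrightarrow> integrable (lebesgue_on {0<..}) H"
    and "ray_converges k M n z w \<theta> \<Longrightarrow>
      ray_integral k M n z w \<theta> = integral\<^sup>L (lebesgue_on {0<..}) H"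
proof -
  define g where "g t = (norm w * t) powr k" for t
  define g' where "g' t = k * norm w * (norm w * t) powr (k - 1)" for t
  have k: "k > 0" using s by simp
  have img: "g ` {0<..} = {0<..}"
  proof (intro equalityI subsetI)
    fix x :: real assume "x \<in> {0<..}"
    then show "x \<in> g ` {0<..}"
      using w s by (intro image_eqI[of _ _ "x powr s / norm w"]) (auto simp: g_def powr_powr)
  qed (use w in \<open>auto simp: g_def\<close>)
  have inj: "inj_on g {0<..}"
  proof (rule inj_onI)
    fix x y :: real assume xy: "x \<in> {0<..}" "y \<in> {0<..}" "g x = g y"
    have "g x powr s = norm w * x" "g y powr s = norm w * y"
      using xy(1,2) s by (simp_all add: g_def powr_powr)
    then have "norm w * x = norm w * y"
      unfolding xy(3) by (rule trans[OF sym])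
    then show "x = y"
      using w by simp
  qed
  have deriv: "(g has_field_derivative g' t) (at t within {0<..})" if "t \<in> {0<..}" for t
    unfolding g_def g'_def using that w
    by (auto intro!: derivative_eq_intros simp: powr_diff)
  have eq: "ray_integrand k M n z w \<theta> t = \<bar>g' t\<bar> *\<^sub>R H (g t)" if "t \<in> {0<..}" for t
  proof -
    have "g t > 0" using that w by (simp add: g_def)
    then have "summable (\<lambda>j. norm (ray_coeff k M n z w \<theta> j * of_real (g t powr (s * real (n + j)))))"
      using s by (intro summable_laplace_series[OF _ \<sigma> summable]) auto
    then have "summable (\<lambda>j. ray_coeff k M n z w \<theta> j * of_real (g t powr (s * real (n + j))))"
      by (rule summable_norm_cancel)
    from ray_integrand_eq_laplace_integrand[OF s w _ this[unfolded g_def]] that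
    show ?thesis by (simp add: H_def g_def g'_def)
  qed
  note lborel = set_integrable_lborel_iff_lebesgue_on[OF measurable_ray_integrand,
      where S = "{0<..}"]
  let ?R = "ray_integrand k M n z w \<theta>"
  have sub: "?R absolutely_integrable_on {0<..} \<and> integral {0<..} ?R = v \<longleftrightarrow>
      H absolutely_integrable_on {0<..} \<and> integral {0<..} H = v" for v
  proof -
    have "?R absolutely_integrable_on {0<..} \<longleftrightarrow>
        (\<lambda>t. \<bar>g' t\<bar> *\<^sub>R H (g t)) absolutely_integrable_on {0<..}"
      by (rule set_integrable_cong) (use eq in auto)
    moreover have "integral {0<..} ?R = integral {0<..} (\<lambda>t. \<bar>g' t\<bar> *\<^sub>R H (g t))"
      by (rule integral_cong) (rule eq)
    ultimately show ?thesis
      using has_absolute_integral_change_of_variables_real[OF _ deriv inj, of H v] img by simp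
  qed
  have iff: "?R absolutely_integrable_on {0<..} \<longleftrightarrow> H absolutely_integrable_on {0<..}"
    using sub by blast
  then show "ray_converges k M n z w \<theta> \<longleftrightarrow> integrable (lebesgue_on {0<..}) H"
    by (simp add: ray_converges_def lborel absolutely_integrable_on_iff_lebesgue_on)
  show "ray_integral k M n z w \<theta> = integral\<^sup>L (lebesgue_on {0<..}) H"
    if "ray_converges k M n z w \<theta>"
  proof -
    from that have R: "integrable (lebesgue_on {0<..}) ?R"
      by (simp add: ray_converges_def lborel)
    then have H: "integrable (lebesgue_on {0<..}) H"
      using iff by (simp add: absolutely_integrable_on_iff_lebesgue_on)
    have "ray_integral k M n z w \<theta> = integral {0<..} ?R"
      by (simp add: ray_integral_def lborel lebesgue_integral_eq_integral[OF R])
    also have "\<dots> = integral {0<..} H"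
      using sub[of "integral {0<..} H"] R H by (simp add: absolutely_integrable_on_iff_lebesgue_on)
    also have "\<dots> = integral\<^sup>L (lebesgue_on {0<..}) H"
      by (simp add: lebesgue_integral_eq_integral[OF H])
    finally show ?thesis .
  qed
qed

lemma admissible_dir_cos_pos:
  assumes "k > 0" "admissible_dir k w \<theta>"
  shows "\<bar>k * (Arg w + \<theta>)\<bar> < pi / 2" "cos (k * (Arg w + \<theta>)) > 0"
proof -
  have "\<bar>Arg w + \<theta>\<bar> < pi / (2 * k)"
    using assms by (auto simp: admissible_dir_def abs_less_iff)
  then have "k * \<bar>Arg w + \<theta>\<bar> < k * (pi / (2 * k))"
    using assms(1) by (intro mult_strict_left_mono)
  then show *: "\<bar>k * (Arg w + \<theta>)\<bar> < pi / 2"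
    using assms(1) by (simp add: abs_mult)
  then show "cos (k * (Arg w + \<theta>)) > 0"
    by (intro cos_gt_zero_pi) auto
qed

text \<open>
  On the ray of direction \<open>\<theta>\<close> the kernel decays like \<open>exp (- c x)\<close> with
  \<open>c = cos (k (Arg w + \<theta>))\<close>, and after scaling \<open>x\<close> by \<open>c\<close> the radius \<open>\<bar>w\<bar>\<close> is replaced by
  \<open>\<bar>w\<bar> c powr s\<close>.
\<close>
lemma ray_convergesI:
  fixes m :: "nat \<Rightarrow> real"
  assumes s: "s > 0" "k = 1 / s" and m: "\<And>j. m j > 0" and w: "w \<noteq> 0"
    and adm: "admissible_dir k w \<theta>"
    and less: "ereal (norm z / (norm w * cos (k * (Arg w + \<theta>)) powr (1 / k)))
      < liminf (\<lambda>j. ereal (root j (m j)))"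
  shows "ray_converges k (generalized_moments s m) n z w \<theta>"
proof -
  define c where "c = cos (k * (Arg w + \<theta>))"
  define M where "M = generalized_moments s m"
  have c: "c > 0"
    using admissible_dir_cos_pos(2)[OF _ adm] s by (simp add: c_def)
  have M_pos: "M j > 0" for j
    unfolding M_def using s m by (intro generalized_moments_pos) auto
  define q where "q = norm z / (norm w * c powr s)"
  have "summable (\<lambda>j. (norm w ^ (n + 1) * c powr (1 + s * real n)) * 
     (norm (ray_coeff k M n z w \<theta> j) * Gamma (1 + s * real (n + j)) * c powr (-1 - s * real (n + j))))"
  proof -
    have "summable (\<lambda>j. q ^ j * (Gamma (1 + s * real (n + j)) / M j))"
      unfolding M_def using less s m
      by (intro summable_generalized_moment_ratio) (auto simp: q_def c_def)
    also have "(\<lambda>j. q ^ j * (Gamma (1 + s * real (n + j)) / M j)) = 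
     (\<lambda>j. (norm w ^ (n + 1) * c powr (1 + s * real n)) * 
     (norm (ray_coeff k M n z w \<theta> j) * Gamma (1 + s * real (n + j)) * c powr (-1 - s * real (n + j))))"
    proof
      fix j
      have "q ^ j = norm z ^ j / (norm w ^ j * c powr (s * real j))"
        using c by (simp add: q_def power_divide power_mult_distrib powr_powr[symmetric] powr_realpow)
      also have "c powr (s * real j) = 1 / (c powr (1 + s * real n) * c powr (-1 - s * real (n + j)))"
        using c by (simp add: powr_add[symmetric] powr_minus_divide[symmetric] algebra_simps)
      finally show "q ^ j * (Gamma (1 + s * real (n + j)) / M j) =
        (norm w ^ (n + 1) * c powr (1 + s * real n)) * 
       (norm (ray_coeff k M n z w \<theta> j) * Gamma (1 + s * real (n + j)) * c powr (-1 - s * real (n + j)))"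
        using M_pos[of j] w c by (simp add: norm_ray_coeff power_add field_simps)
    qed
    finally show ?thesis .
  qed
  then have summable: "summable (\<lambda>j. norm (ray_coeff k M n z w \<theta> j) *
      Gamma (1 + s * real (n + j)) * c powr (-1 - s * real (n + j)))"
    by (rule summable_mult_D) (use w c in auto)
  have "ray_converges k M n z w \<theta>"
    unfolding ray_substitution(1)[OF s w c summable]
    by (rule laplace_series(1)) (use s c summable in \<open>auto simp: c_def\<close>)
  then show ?thesis by (simp add: M_def)
qed

text \<open>
  The value does not depend on the direction: the phase \<open>cis \<theta>\<close> of \<open>\<zeta>\<close> and the phase of the power of
  \<open>cis (k (Arg w + \<theta>))\<close> produced by the Laplace integral combine to the phase of a power of \<open>w\<close>.
\<close>
lemma ray_integral_sums:
  fixes m :: "nat \<Rightarrow> real"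
  assumes s: "s > 0" "k = 1 / s" and m: "\<And>j. m j > 0" and w: "w \<noteq> 0"
    and adm: "admissible_dir k w \<theta>" and conv: "ray_converges k (generalized_moments s m) n z w \<theta>"
    and less: "ereal (norm z / norm w) < liminf (\<lambda>j. ereal (root j (m j)))"
  shows "(\<lambda>j. z ^ j * of_real (Gamma (1 + s * real (n + j)) / generalized_moments s m j) /
      w ^ (n + j + 1)) sums ray_integral k (generalized_moments s m) n z w \<theta>"
proof -
  define M where "M = generalized_moments s m"
  define \<psi> where "\<psi> = Arg w + \<theta>"
  define p where "p = cis (k * \<psi>)"
  have k: "k > 0" using s by simp
  note adm' = admissible_dir_cos_pos[OF k adm, folded \<psi>_def]
  have M_pos: "M j > 0" for j
    unfolding M_def using s m by (intro generalized_moments_pos) auto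
  have "summable (\<lambda>j. (norm z / norm w) ^ j * (Gamma (1 + s * real (n + j)) / M j))"
    unfolding M_def using less s m by (intro summable_generalized_moment_ratio) auto
  also have "(\<lambda>j. (norm z / norm w) ^ j * (Gamma (1 + s * real (n + j)) / M j)) =
      (\<lambda>j. norm w ^ (n + 1) * (norm (ray_coeff k M n z w \<theta> j) * Gamma (1 + s * real (n + j))))"
  proof
    fix j
    show "(norm z / norm w) ^ j * (Gamma (1 + s * real (n + j)) / M j) =
        norm w ^ (n + 1) * (norm (ray_coeff k M n z w \<theta> j) * Gamma (1 + s * real (n + j)))"
      using M_pos[of j] w by (simp add: norm_ray_coeff power_add power_divide field_simps)
  qed
  finally have summable: "summable (\<lambda>j. norm (ray_coeff k M n z w \<theta> j) * Gamma (1 + s * real (n + j)))"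
    by (rule summable_mult_D) (use w in auto)
  have p: "Re p > 0" "norm p = 1"
    using adm' by (simp_all add: p_def)
  have summable': "summable (\<lambda>j. norm (ray_coeff k M n z w \<theta> j) * Gamma (1 + s * real (n + j)) *
      1 powr (-1 - s * real (n + j)))"
    using summable by simp
  note sub = ray_substitution[OF s w zero_less_one summable', folded \<psi>_def, folded p_def]
  have conv': "ray_converges k M n z w \<theta>" using conv by (simp add: M_def)
  have "(\<lambda>j. ray_coeff k M n z w \<theta> j * of_real (Gamma (1 + s * real (n + j))) *
      p powr of_real (-1 - s * real (n + j))) sums ray_integral k M n z w \<theta>"
    unfolding sub(2)[OF conv']
    by (rule laplace_series_of_integrable) (use s p summable conv' sub(1) in auto)
  also have "(\<lambda>j. ray_coeff k M n z w \<theta> j * of_real (Gamma (1 + s * real (n + j))) *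
      p powr of_real (-1 - s * real (n + j))) =
      (\<lambda>j. z ^ j * of_real (Gamma (1 + s * real (n + j)) / M j) / w ^ (n + j + 1))"
  proof
    fix j
    define N where "N = n + j"
    \<comment> \<open>The principal branch applies because \<open>\<bar>k \<psi>\<bar> < \<pi> / 2\<close>; multiplication by \<open>s = 1 / k\<close> turns \<open>k \<psi>\<close> into \<open>\<psi>\<close>.\<close>
    have "p powr of_real (-1 - s * real N) = cis (- (k * \<psi>) - \<psi> * real N)"
    proof -
      have "Ln p = \<i> * of_real (k * \<psi>)"
        unfolding p_def cis_conv_exp using adm'(1) pi_gt_zero by (intro Ln_exp) auto
      then have "p powr of_real (-1 - s * real N) = exp (\<i> * of_real ((-1 - s * real N) * (k * \<psi>)))"
        by (simp add: powr_def p_def algebra_simps)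
      also have "(-1 - s * real N) * (k * \<psi>) = - (k * \<psi>) - \<psi> * real N"
        using s by (simp add: field_simps)
      finally show ?thesis by (simp add: cis_conv_exp)
    qed
    moreover have "\<theta> + (k - 1) * \<psi> + real N * \<theta> + (- (k * \<psi>) - \<psi> * real N) = real (N + 1) * (- Arg w)"
      by (simp add: \<psi>_def algebra_simps)
    then have "cis \<theta> * cis ((k - 1) * \<psi>) * cis \<theta> ^ N * cis (- (k * \<psi>) - \<psi> * real N) =
        inverse (cis (Arg w)) ^ (N + 1)"
      by (simp only: cis_inverse Complex.DeMoivre cis_mult)
    moreover have "of_real (norm w) * cis (Arg w) = w"
      using w by (simp add: cis_Arg complex_sgn_def scaleR_conv_of_real)
    then have "w ^ (N + 1) = of_real (norm w) ^ (N + 1) * cis (Arg w) ^ (N + 1)"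
      by (metis power_mult_distrib)
    ultimately have "cis \<theta> * cis ((k - 1) * \<psi>) / of_real (norm w) * (cis \<theta> / of_real (norm w)) ^ N *
        p powr of_real (-1 - s * real N) = 1 / w ^ (N + 1)"
      using w by (simp add: power_divide divide_simps mult_ac)
    then have "(cis \<theta> * cis ((k - 1) * \<psi>) / of_real (norm w) * (cis \<theta> / of_real (norm w)) ^ N *
        p powr of_real (-1 - s * real N)) * (z ^ j * of_real (Gamma (1 + s * real N) / M j)) =
        1 / w ^ (N + 1) * (z ^ j * of_real (Gamma (1 + s * real N) / M j))"
      by (rule arg_cong)
    then show "ray_coeff k M n z w \<theta> j * of_real (Gamma (1 + s * real (n + j))) *
        p powr of_real (-1 - s * real (n + j)) =
        z ^ j * of_real (Gamma (1 + s * real (n + j)) / M j) / w ^ (n + j + 1)"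
      unfolding ray_coeff_def \<psi>_def[symmetric] N_def by (simp add: mult_ac)
  qed
  finally show ?thesis by (simp only: M_def)
qed

section \<open>The contour integral\<close>

lemma fps_nth_moment_deriv_power:
  assumes "\<And>j. M j \<noteq> 0"
  shows "fps_nth ((moment_deriv M ^^ n) u) j = (M (n + j) / M j) *\<^sub>R fps_nth u (n + j)"
  using assms by (induction n arbitrary: j) (simp_all add: moment_deriv_def)

text \<open>
  The series in negative powers of \<open>w\<close> converges uniformly on the circle, so it may be integrated term
  by term against \<open>B\<close>; Cauchy's formula then picks out one Taylor coefficient of \<open>B\<close> from each term.
\<close>
lemma contour_integral_Laurent_pairing:
  fixes B R :: "complex \<Rightarrow> complex" and d :: "nat \<Rightarrow> complex"
  assumes r: "0 < \<epsilon>" "\<epsilon> < r" and B: "B holomorphic_on ball 0 r"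
    and d: "summable (\<lambda>j. norm (d j) / \<epsilon> ^ (n + j + 1))"
    and R: "\<And>w. norm w = \<epsilon> \<Longrightarrow> (\<lambda>j. d j / w ^ (n + j + 1)) sums R w"
  shows "(\<lambda>w. B w * R w) contour_integrable_on circlepath 0 \<epsilon>"
    and "(\<lambda>j. d j * fps_nth (fps_expansion B 0) (n + j)) sums
      (1 / (2 * of_real pi * \<i>) * contour_integral (circlepath 0 \<epsilon>) (\<lambda>w. B w * R w))"
proof -
  define S where "S N w = (\<Sum>j<N. B w * (d j / w ^ (n + j + 1)))" for N w
  have B_cball: "B holomorphic_on cball 0 \<epsilon>"
    using r by (intro holomorphic_on_subset[OF B]) auto
  have term_int: "((\<lambda>w. B w * (d j / w ^ (n + j + 1))) has_contour_integral
      (2 * of_real pi * \<i>) * (d j * fps_nth (fps_expansion B 0) (n + j))) (circlepath 0 \<epsilon>)" for j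
  proof -
    have "((\<lambda>u. B u / (u - 0) ^ Suc (n + j)) has_contour_integral
        2 * pi * \<i> / fact (n + j) * (deriv ^^ (n + j)) B 0) (circlepath 0 \<epsilon>)"
      using r by (intro Cauchy_has_contour_integral_higher_derivative_circlepath
          holomorphic_on_imp_continuous_on[OF B_cball] holomorphic_on_subset[OF B_cball]) auto
    from has_contour_integral_lmul[OF this, of "d j"] show ?thesis
      by (simp add: fps_expansion_def mult_ac divide_inverse)
  qed
  have S_int: "(S N has_contour_integral (\<Sum>j<N. (2 * of_real pi * \<i>) *
      (d j * fps_nth (fps_expansion B 0) (n + j)))) (circlepath 0 \<epsilon>)" for N
    unfolding S_def by (intro has_contour_integral_sum term_int) auto
  have "continuous_on (sphere 0 \<epsilon>) B"
    by (rule continuous_on_subset[OF holomorphic_on_imp_continuous_on[OF B_cball]]) auto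
  then have "bounded (B ` sphere 0 \<epsilon>)"
    by (intro compact_imp_bounded compact_continuous_image compact_sphere)
  then obtain C where C: "\<And>w. w \<in> sphere 0 \<epsilon> \<Longrightarrow> norm (B w) \<le> C"
    unfolding bounded_iff by blast
  have "uniform_limit (sphere 0 \<epsilon>) S (\<lambda>w. \<Sum>j. B w * (d j / w ^ (n + j + 1))) sequentially"
    unfolding S_def
  proof (rule Weierstrass_m_test)
    show "summable (\<lambda>j. C * (norm (d j) / \<epsilon> ^ (n + j + 1)))"
      using d by (rule summable_mult)
    fix j w assume w: "w \<in> sphere (0::complex) \<epsilon>"
    have "norm (B w) * (norm (d j) / \<epsilon> ^ (n + j + 1)) \<le> C * (norm (d j) / \<epsilon> ^ (n + j + 1))"
      using C[OF w] r by (intro mult_right_mono) auto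
    then show "norm (B w * (d j / w ^ (n + j + 1))) \<le> C * (norm (d j) / \<epsilon> ^ (n + j + 1))"
      using w by (simp add: norm_mult norm_divide norm_power)
  qed
  then have lim: "uniform_limit (sphere 0 \<epsilon>) S (\<lambda>w. B w * R w) sequentially"
  proof (rule uniform_limit_cong'[THEN iffD1, rotated -1])
    fix w assume "w \<in> sphere (0::complex) \<epsilon>"
    then show "(\<Sum>j. B w * (d j / w ^ (n + j + 1))) = B w * R w"
      by (intro sums_unique[symmetric] sums_mult R) auto
  qed auto
  have ev: "\<forall>\<^sub>F N in sequentially. S N contour_integrable_on circlepath 0 \<epsilon>"
    using S_int unfolding contour_integrable_on_def by (intro always_eventually allI exI)
  note * = contour_integral_uniform_limit_circlepath[OF ev lim trivial_limit_sequentially r(1)]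
  from * show "(\<lambda>w. B w * R w) contour_integrable_on circlepath 0 \<epsilon>" by blast
  have "(\<lambda>N. \<Sum>j<N. (2 * of_real pi * \<i>) * (d j * fps_nth (fps_expansion B 0) (n + j)))
      \<longlonglongrightarrow> contour_integral (circlepath 0 \<epsilon>) (\<lambda>w. B w * R w)"
    using *(2) unfolding contour_integral_unique[OF S_int] .
  then have "(\<lambda>j. (2 * of_real pi * \<i>) * (d j * fps_nth (fps_expansion B 0) (n + j))) sums
      contour_integral (circlepath 0 \<epsilon>) (\<lambda>w. B w * R w)"
    by (simp add: sums_def)
  from sums_mult[OF this, of "1 / (2 * of_real pi * \<i>)"]
  show "(\<lambda>j. d j * fps_nth (fps_expansion B 0) (n + j)) sums
      (1 / (2 * of_real pi * \<i>) * contour_integral (circlepath 0 \<epsilon>) (\<lambda>w. B w * R w))"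
    by simp
qed

text \<open>
  The coefficients are multiplied by \<open>m j \<le> A ^ j\<close>, so the radius of convergence shrinks at most by
  the factor \<open>A\<close>.
\<close>
lemma borel_fun_inverse_holomorphic:
  fixes m :: "nat \<Rightarrow> real"
  assumes m: "\<And>j. m j > 0" "\<And>j. m j \<le> A ^ j" and A: "A > 0"
    and \<phi>: "\<phi> holomorphic_on ball 0 r"
  shows "borel_fun (\<lambda>j. inverse (m j)) \<phi> holomorphic_on ball 0 (r / A)"
    and "r > 0 \<Longrightarrow> fps_nth (fps_expansion (borel_fun (\<lambda>j. inverse (m j)) \<phi>) 0) j =
      of_real (m j) * fps_nth (fps_expansion \<phi> 0) j"
proof -
  define F where "F = borel_op (\<lambda>j. inverse (m j)) (fps_expansion \<phi> 0)"
  have nth_F: "fps_nth F j = of_real (m j) * fps_nth (fps_expansion \<phi> 0) j" for j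
    by (simp add: F_def borel_op_def scaleR_conv_of_real)
  have radius: "fps_conv_radius F \<ge> ereal (r / A)"
    unfolding fps_conv_radius_def
  proof (rule conv_radius_geI_ex')
    fix x :: real assume x: "0 < x" "ereal x < ereal (r / A)"
    have "ereal (norm (complex_of_real (A * x))) < ereal r"
      using x A by (simp add: norm_mult field_simps)
    also have "ereal r \<le> fps_conv_radius (fps_expansion \<phi> 0)"
      using \<phi> by (intro conv_radius_fps_expansion) simp
    finally have "ereal (norm (complex_of_real (A * x))) < fps_conv_radius (fps_expansion \<phi> 0)" .
    then have "summable (\<lambda>j. norm (fps_nth (fps_expansion \<phi> 0) j * of_real (A * x) ^ j))"
      unfolding fps_conv_radius_def by (rule abs_summable_in_conv_radius)
    then show "summable (\<lambda>j. fps_nth F j * of_real x ^ j)"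
    proof (rule summable_comparison_test'[of _ 0])
      fix j
      have "m j * (norm (fps_nth (fps_expansion \<phi> 0) j) * x ^ j) \<le>
          A ^ j * (norm (fps_nth (fps_expansion \<phi> 0) j) * x ^ j)"
        using m(2) x by (intro mult_right_mono) auto
      then show "norm (fps_nth F j * of_real x ^ j) \<le>
          norm (fps_nth (fps_expansion \<phi> 0) j * of_real (A * x) ^ j)"
        using m(1)[of j] x A
        by (simp add: nth_F norm_mult norm_power power_mult_distrib mult_ac)
    qed
  qed
  have borel_fun_eq: "borel_fun (\<lambda>j. inverse (m j)) \<phi> = eval_fps F"
    by (simp add: borel_fun_def F_def)
  have "ball 0 (r / A) \<subseteq> eball (0::complex) (fps_conv_radius F)"
    using less_le_trans[OF _ radius] by (auto simp: in_eball_iff)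
  then show "borel_fun (\<lambda>j. inverse (m j)) \<phi> holomorphic_on ball 0 (r / A)"
    unfolding borel_fun_eq by (intro holomorphic_on_eval_fps) auto
  show "fps_nth (fps_expansion (borel_fun (\<lambda>j. inverse (m j)) \<phi>) 0) j =
      of_real (m j) * fps_nth (fps_expansion \<phi> 0) j" if "r > 0"
  proof -
    have "0 < ereal (r / A)" using that A by simp
    then have "0 < fps_conv_radius F" using radius by (rule less_le_trans)
    then have "eval_fps F has_fps_expansion F"
      by (rule eval_fps_has_fps_expansion)
    then show ?thesis
      unfolding borel_fun_eq by (simp add: fps_expansion_eqI nth_F)
  qed
qed

text \<open>
  The factor \<open>m (n + j) \<le> A ^ (n + j)\<close> is absorbed by the decay of the Taylor coefficients of \<open>\<phi>\<close>,
  because \<open>A \<epsilon> < r\<close>. There remains \<open>1 / m j\<close>, and a \<open>q\<close> slightly above \<open>\<bar>z\<bar> / \<epsilon>\<close> shows convergence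
  on a disc of radius \<open>q \<epsilon> > \<bar>z\<bar>\<close>.
\<close>
lemma norm_less_conv_radius_moment_deriv_series:
  fixes m :: "nat \<Rightarrow> real" and z :: complex
  assumes s: "s > 0" and m: "\<And>j. m j > 0" "\<And>j. m j \<le> A ^ j" and A: "A > 0"
    and \<phi>: "\<phi> holomorphic_on ball 0 r" and \<epsilon>: "0 < \<epsilon>" "\<epsilon> < r / A"
    and less: "ereal (norm z / \<epsilon>) < liminf (\<lambda>j. ereal (root j (m j)))"
  shows "norm z < fps_conv_radius (moment_deriv_series (generalized_moments s m) n \<phi>)"
proof -
  define M where "M = generalized_moments s m"
  have M_pos: "M j > 0" for j
    unfolding M_def using s m by (intro generalized_moments_pos) auto
  then have M_nonzero: "M j \<noteq> 0" for j
    by (metis less_irrefl)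
  have M_shift: "M (n + j) = Gamma (1 + s * real (n + j)) * m (n + j)" for j
    by (simp add: M_def generalized_moments_def Gamma_seq_def)
  from less obtain q where q: "norm z / \<epsilon> < q" "ereal q < liminf (\<lambda>j. ereal (root j (m j)))"
    using ereal_dense2 less_ereal.simps(1) by blast
  have z: "norm z < q * \<epsilon>" using q \<epsilon> by (simp add: field_simps)
  have q0: "q \<ge> 0" using q \<epsilon> by (smt (verit) divide_nonneg_pos norm_ge_zero)
  have "ereal (norm (complex_of_real (A * \<epsilon>))) < ereal r"
    using \<epsilon> A by (simp add: norm_mult field_simps)
  also have "ereal r \<le> fps_conv_radius (fps_expansion \<phi> 0)"
    using \<phi> by (intro conv_radius_fps_expansion) simp
  finally have "ereal (norm (complex_of_real (A * \<epsilon>))) < fps_conv_radius (fps_expansion \<phi> 0)" .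
  then have "summable (\<lambda>j. fps_nth (fps_expansion \<phi> 0) j * of_real (A * \<epsilon>) ^ j)"
    unfolding fps_conv_radius_def by (rule summable_in_conv_radius)
  then have "Bseq (\<lambda>j. fps_nth (fps_expansion \<phi> 0) j * of_real (A * \<epsilon>) ^ j)"
    by (rule summable_imp_Bseq)
  then obtain C where C: "\<And>j. norm (fps_nth (fps_expansion \<phi> 0) j * of_real (A * \<epsilon>) ^ j) \<le> C"
    unfolding Bseq_def by blast
  have \<phi>_le: "norm (fps_nth (fps_expansion \<phi> 0) j) * A ^ j \<le> C / \<epsilon> ^ j" for j
    using C[of j] \<epsilon> A by (simp add: norm_mult norm_power power_mult_distrib field_simps)
  have "summable (\<lambda>j. fps_nth (moment_deriv_series M n \<phi>) j * of_real (q * \<epsilon>) ^ j)"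
  proof (rule summable_comparison_test'[of _ 0])
    show "summable (\<lambda>j. C / \<epsilon> ^ n * (q ^ j * (Gamma (1 + s * real (n + j)) / M j)))"
      unfolding M_def by (intro summable_mult summable_generalized_moment_ratio s m q0 q)
    fix j
    have G: "Gamma (1 + s * real (n + j)) > 0"
      using s by (intro Gamma_real_pos add_pos_nonneg) auto
    have "norm (fps_nth (moment_deriv_series M n \<phi>) j * of_real (q * \<epsilon>) ^ j) =
        Gamma (1 + s * real (n + j)) / M j * (q * \<epsilon>) ^ j *
        (norm (fps_nth (fps_expansion \<phi> 0) (n + j)) * m (n + j))"
      unfolding moment_deriv_series_def fps_nth_moment_deriv_power[of M, OF M_nonzero] M_shift
      using M_pos[of j] G m(1)[of "n + j"] q0 \<epsilon> by (simp add: norm_mult norm_power abs_mult)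
    also have "\<dots> \<le> Gamma (1 + s * real (n + j)) / M j * (q * \<epsilon>) ^ j * (C / \<epsilon> ^ (n + j))"
    proof (rule mult_left_mono)
      have "norm (fps_nth (fps_expansion \<phi> 0) (n + j)) * m (n + j) \<le>
          norm (fps_nth (fps_expansion \<phi> 0) (n + j)) * A ^ (n + j)"
        by (intro mult_left_mono m) auto
      also note \<phi>_le
      finally show "norm (fps_nth (fps_expansion \<phi> 0) (n + j)) * m (n + j) \<le> C / \<epsilon> ^ (n + j)" .
    qed (use G M_pos[of j] q0 \<epsilon> in auto)
    also have "\<dots> = C / \<epsilon> ^ n * (q ^ j * (Gamma (1 + s * real (n + j)) / M j))"
      using \<epsilon> by (simp add: power_add power_mult_distrib field_simps)
    finally show "norm (fps_nth (moment_deriv_series M n \<phi>) j * of_real (q * \<epsilon>) ^ j) \<le>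
        C / \<epsilon> ^ n * (q ^ j * (Gamma (1 + s * real (n + j)) / M j))" .
  qed
  then have "ereal (norm (complex_of_real (q * \<epsilon>))) \<le> fps_conv_radius (moment_deriv_series M n \<phi>)"
    unfolding fps_conv_radius_def by (rule conv_radius_geI)
  moreover have "ereal (norm z) < ereal (norm (complex_of_real (q * \<epsilon>)))"
    using z q0 \<epsilon> by (simp add: norm_mult)
  ultimately show ?thesis
    unfolding M_def by (rule less_le_trans[rotated])
qed

section \<open>The integral representation\<close>

theorem theorem3:
  fixes s k a A r \<epsilon> :: real
    and m M :: "nat \<Rightarrow> real"
    and \<phi> :: "complex \<Rightarrow> complex"
    and n :: nat
    and z :: complex
  assumes "s > 0" and "k = 1 / s"
    and "m 0 = 1" and "\<And>j. m j > 0"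
    and "preserves_summability TYPE('e::complex_banach) m"
    and "a > 0" and "A > 0" and "\<And>j. a ^ j \<le> m j \<and> m j \<le> A ^ j"
    and "M = generalized_moments s m"
    and "r > 0" and "\<phi> holomorphic_on ball 0 r"
    and "norm z < \<epsilon>" and "\<epsilon> < r / A"
    and "ereal (norm z / \<epsilon>) < liminf (\<lambda>j. ereal (root j (m j)))"
  shows "norm z < fps_conv_radius (moment_deriv_series M n \<phi>) \<and>
    (\<forall>w\<in>sphere 0 \<epsilon>. \<forall>\<theta>. admissible_dir k w \<theta> \<and>
       ereal (norm z / (\<epsilon> * cos (k * (Arg w + \<theta>)) powr (1 / k)))
         < liminf (\<lambda>j. ereal (root j (m j))) \<longrightarrow>
       ray_converges k M n z w \<theta>) \<and>
    (\<forall>\<theta> :: complex \<Rightarrow> real.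
       (\<forall>w\<in>sphere 0 \<epsilon>. admissible_dir k w (\<theta> w) \<and> ray_converges k M n z w (\<theta> w)) \<longrightarrow>
       (\<lambda>w. borel_fun (\<lambda>j. inverse (m j)) \<phi> w * ray_integral k M n z w (\<theta> w))
         contour_integrable_on circlepath 0 \<epsilon> \<and>
       eval_fps (moment_deriv_series M n \<phi>) z =
         1 / (2 * of_real pi * \<i>) *
         contour_integral (circlepath 0 \<epsilon>)
           (\<lambda>w. borel_fun (\<lambda>j. inverse (m j)) \<phi> w * ray_integral k M n z w (\<theta> w)))"
proof (intro conjI ballI allI impI; (elim conjE)?)
  note s = assms(1,2) and m = assms(4) and M = assms(9) and less = assms(14)
  have m_le: "m j \<le> A ^ j" for j using assms(8) by blast
  have \<epsilon>: "\<epsilon> > 0" using assms(12) norm_ge_zero[of z] by linarith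
  have M_pos: "M j > 0" for j
    unfolding M using s m by (intro generalized_moments_pos) auto
  then have M_nonzero: "M j \<noteq> 0" for j
    by (metis less_irrefl)
  have M_shift: "M (n + j) = Gamma (1 + s * real (n + j)) * m (n + j)" for j
    by (simp add: M generalized_moments_def Gamma_seq_def)
  show "norm z < fps_conv_radius (moment_deriv_series M n \<phi>)"
    unfolding M by (rule norm_less_conv_radius_moment_deriv_series[OF s(1) m m_le assms(7,11) \<epsilon> assms(13) less])
  show "ray_converges k M n z w \<theta>" if "w \<in> sphere 0 \<epsilon>" "admissible_dir k w \<theta>"
    "ereal (norm z / (\<epsilon> * cos (k * (Arg w + \<theta>)) powr (1 / k))) < liminf (\<lambda>j. ereal (root j (m j)))"
    for w \<theta>
    unfolding M using that \<epsilon> by (intro ray_convergesI[OF s m]) auto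
  fix \<theta> :: "complex \<Rightarrow> real"
  assume \<theta>: "\<forall>w\<in>sphere 0 \<epsilon>. admissible_dir k w (\<theta> w) \<and> ray_converges k M n z w (\<theta> w)"
  define d where "d j = z ^ j * of_real (Gamma (1 + s * real (n + j)) / M j)" for j
  have sums_R: "(\<lambda>j. d j / w ^ (n + j + 1)) sums ray_integral k M n z w (\<theta> w)"
    if "norm w = \<epsilon>" for w
    using ray_integral_sums[OF s m, where w = w and \<theta> = "\<theta> w" and n = n and z = z] \<theta> that \<epsilon> less by (auto simp: d_def M)
  have "summable (\<lambda>j. 1 / \<epsilon> ^ (n + 1) * ((norm z / \<epsilon>) ^ j * (Gamma (1 + s * real (n + j)) / M j)))"
    unfolding M using \<epsilon> by (intro summable_mult summable_generalized_moment_ratio s m less) auto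
  also have "(\<lambda>j. 1 / \<epsilon> ^ (n + 1) * ((norm z / \<epsilon>) ^ j * (Gamma (1 + s * real (n + j)) / M j))) =
      (\<lambda>j. norm (d j) / \<epsilon> ^ (n + j + 1))"
  proof
    fix j
    have "Gamma (1 + s * real (n + j)) > 0"
      using s by (intro Gamma_real_pos add_pos_nonneg) auto
    then show "1 / \<epsilon> ^ (n + 1) * ((norm z / \<epsilon>) ^ j * (Gamma (1 + s * real (n + j)) / M j)) =
        norm (d j) / \<epsilon> ^ (n + j + 1)"
      unfolding d_def norm_mult norm_power norm_of_real using M_pos[of j] \<epsilon>
      by (simp add: power_add power_divide)
  qed
  finally have summable_d: "summable (\<lambda>j. norm (d j) / \<epsilon> ^ (n + j + 1))" .
  note B = borel_fun_inverse_holomorphic[OF m m_le assms(7,11)]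
  note pairing = contour_integral_Laurent_pairing[OF \<epsilon> assms(13) B(1) summable_d sums_R]
  show "(\<lambda>w. borel_fun (\<lambda>j. inverse (m j)) \<phi> w * ray_integral k M n z w (\<theta> w))
         contour_integrable_on circlepath 0 \<epsilon>"
    by (rule pairing(1))
  have "d j * fps_nth (fps_expansion (borel_fun (\<lambda>j. inverse (m j)) \<phi>) 0) (n + j) =
      fps_nth (moment_deriv_series M n \<phi>) j * z ^ j" for j
    unfolding B(2)[OF assms(10)] moment_deriv_series_def
      fps_nth_moment_deriv_power[of M, OF M_nonzero] M_shift
    by (simp add: d_def scaleR_conv_of_real)
  then show "eval_fps (moment_deriv_series M n \<phi>) z =
         1 / (2 * of_real pi * \<i>) *
         contour_integral (circlepath 0 \<epsilon>)
           (\<lambda>w. borel_fun (\<lambda>j. inverse (m j)) \<phi> w * ray_integral k M n z w (\<theta> w))"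
    using pairing(2) unfolding eval_fps_def by (simp only: sums_iff)
qed

end
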